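(* Let $1<q<2$ and $\alpha>0$. Let $\Omega\subset\mathbb{R}^N$ be an open bounded connected set. Let $w$ be the unique positive minimizer of $\mathfrak{F}_{q,\alpha}$ over $W^{1,2}_0(\Omega)$. Let $\widetilde\Gamma^1_\infty$ be the set of all $\gamma\in C([0,+\infty);L^1(\Omega))$ such that $\mathrm{Im}(\gamma)\subset W^{1,2}_0(\Omega)$, $\gamma(0)=w$ and $\lim_{t\to+\infty}\|\gamma(t)-(-w)\|_{L^1(\Omega)}=0$, and set $$\nu^*_\infty:=\inf_{\gamma\in\widetilde\Gamma^1_\infty}\ \sup_{\varphi\in\mathrm{Im}(\gamma)}\mathfrak{F}_{q,\alpha}(\varphi).$$ Then $\nu^*_\infty=\Lambda^*$, where $$\Lambda^*:=\inf_{\gamma\in\Gamma}\ \max_{\varphi\in\mathrm{Im}(\gamma)}\mathfrak{F}_{q,\alpha}(\varphi),\qquad \Gamma=\big\{\gamma\in C([0,1];W^{1,2}_0(\Omega)):\gamma(0)=w,\ \gamma(1)=-w\big\}.$$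
   Context: $W^{1,2}_0(\Omega)$ is the closure of $C^\infty_0(\Omega)$ in the $W^{1,2}(\Omega)$ norm, endowed with the norm $\|\varphi\|_{W^{1,2}_0(\Omega)}=\|\nabla\varphi\|_{L^2(\Omega)}$. For $\varphi\in W^{1,2}_0(\Omega)$, $$\mathfrak{F}_{q,\alpha}(\varphi)=\frac12\int_\Omega|\nabla\varphi|^2\,dx-\frac{\alpha}{q}\int_\Omega|\varphi|^q\,dx.$$ The functional $\mathfrak{F}_{q,\alpha}$ has exactly two minimizers on $W^{1,2}_0(\Omega)$, namely $w>0$ and $-w$. $\mathrm{Im}(\gamma)$ denotes the image of $\gamma$. *)

theory Defs
  imports "HOL-Analysis.Analysis"
begin

text \<open>
  \<open>\<real>\<^sup>N\<close> is an arbitrary Euclidean space \<^typ>\<open>'a::euclidean_space\<close> (so \<open>N = DIM('a) \<ge> 1\<close>). Elements of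
  \<open>L\<^sup>1(\<Omega>)\<close>, \<open>L\<^sup>2(\<Omega>)\<close> and of the Sobolev spaces are given by representatives \<^typ>\<open>'a \<Rightarrow> real\<close>, of which
  only the values on \<open>\<Omega>\<close> matter, up to null sets; equality of two elements is equality almost
  everywhere with respect to \<^term>\<open>lebesgue_on \<Omega>\<close>, and the norms below do not depend on the
  representatives.
\<close>

fun Ck :: "nat \<Rightarrow> ('a::euclidean_space \<Rightarrow> real) \<Rightarrow> bool" where
  "Ck 0 f \<longleftrightarrow> continuous_on UNIV f"
| "Ck (Suc k) f \<longleftrightarrow>
     f differentiable_on UNIV \<and> (\<forall>i\<in>Basis. Ck k (\<lambda>x. frechet_derivative f (at x) i))"

definition test_functions :: "'a::euclidean_space set \<Rightarrow> ('a \<Rightarrow> real) set" where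
  "test_functions \<Omega> =
     {\<psi>. (\<forall>k. Ck k \<psi>) \<and> compact (closure {x. \<psi> x \<noteq> 0}) \<and> closure {x. \<psi> x \<noteq> 0} \<subseteq> \<Omega>}"

definition L1 :: "'a::euclidean_space set \<Rightarrow> ('a \<Rightarrow> real) set" where
  "L1 \<Omega> = {f. integrable (lebesgue_on \<Omega>) f}"

definition L1_norm :: "'a::euclidean_space set \<Rightarrow> ('a \<Rightarrow> real) \<Rightarrow> real" where
  "L1_norm \<Omega> f = (LINT x|lebesgue_on \<Omega>. \<bar>f x\<bar>)"

definition L2 :: "'a::euclidean_space set \<Rightarrow> ('a \<Rightarrow> 'b::euclidean_space) set" where
  "L2 \<Omega> = {f. f \<in> borel_measurable (lebesgue_on \<Omega>) \<and>
              integrable (lebesgue_on \<Omega>) (\<lambda>x. (norm (f x))\<^sup>2)}"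

definition L2_norm :: "'a::euclidean_space set \<Rightarrow> ('a \<Rightarrow> 'b::euclidean_space) \<Rightarrow> real" where
  "L2_norm \<Omega> f = sqrt (LINT x|lebesgue_on \<Omega>. (norm (f x))\<^sup>2)"

definition has_weak_gradient ::
  "'a::euclidean_space set \<Rightarrow> ('a \<Rightarrow> real) \<Rightarrow> ('a \<Rightarrow> 'a) \<Rightarrow> bool" where
  "has_weak_gradient \<Omega> \<phi> G \<longleftrightarrow> \<phi> \<in> L2 \<Omega> \<and> G \<in> L2 \<Omega> \<and>
     (\<forall>\<psi>\<in>test_functions \<Omega>. \<forall>i\<in>Basis.
        (LINT x|lebesgue_on \<Omega>. \<phi> x * frechet_derivative \<psi> (at x) i) =
        - (LINT x|lebesgue_on \<Omega>. (G x \<bullet> i) * \<psi> x))"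

text \<open>The weak gradient is unique up to null sets, so the choice below is immaterial.\<close>

definition weak_gradient :: "'a::euclidean_space set \<Rightarrow> ('a \<Rightarrow> real) \<Rightarrow> 'a \<Rightarrow> 'a" where
  "weak_gradient \<Omega> \<phi> = (SOME G. has_weak_gradient \<Omega> \<phi> G)"

definition W12 :: "'a::euclidean_space set \<Rightarrow> ('a \<Rightarrow> real) set" where
  "W12 \<Omega> = {\<phi>. \<exists>G. has_weak_gradient \<Omega> \<phi> G}"

definition W12_norm :: "'a::euclidean_space set \<Rightarrow> ('a \<Rightarrow> real) \<Rightarrow> real" where
  "W12_norm \<Omega> \<phi> = sqrt ((L2_norm \<Omega> \<phi>)\<^sup>2 + (L2_norm \<Omega> (weak_gradient \<Omega> \<phi>))\<^sup>2)"

definition W12_0 :: "'a::euclidean_space set \<Rightarrow> ('a \<Rightarrow> real) set" where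
  "W12_0 \<Omega> = {\<phi>\<in>W12 \<Omega>. \<forall>\<epsilon>>0. \<exists>\<psi>\<in>test_functions \<Omega>. W12_norm \<Omega> (\<lambda>x. \<phi> x - \<psi> x) < \<epsilon>}"

definition W12_0_norm :: "'a::euclidean_space set \<Rightarrow> ('a \<Rightarrow> real) \<Rightarrow> real" where
  "W12_0_norm \<Omega> \<phi> = L2_norm \<Omega> (weak_gradient \<Omega> \<phi>)"

definition energy ::
  "real \<Rightarrow> real \<Rightarrow> 'a::euclidean_space set \<Rightarrow> ('a \<Rightarrow> real) \<Rightarrow> real" where
  "energy q \<alpha> \<Omega> \<phi> =
     1/2 * (LINT x|lebesgue_on \<Omega>. (norm (weak_gradient \<Omega> \<phi> x))\<^sup>2)
     - \<alpha> / q * (LINT x|lebesgue_on \<Omega>. \<bar>\<phi> x\<bar> powr q)"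

definition positive_minimizer ::
  "real \<Rightarrow> real \<Rightarrow> 'a::euclidean_space set \<Rightarrow> ('a \<Rightarrow> real) \<Rightarrow> bool" where
  "positive_minimizer q \<alpha> \<Omega> w \<longleftrightarrow>
     w \<in> W12_0 \<Omega> \<and> (\<forall>\<phi>\<in>W12_0 \<Omega>. energy q \<alpha> \<Omega> w \<le> energy q \<alpha> \<Omega> \<phi>) \<and>
     (AE x in lebesgue_on \<Omega>. w x > 0)"

text \<open>
  A path is a function on \<^typ>\<open>real\<close> of which only the values on \<open>[0,\<infinity>)\<close>, respectively \<open>[0,1]\<close>,
  matter. Continuity is spelled out in terms of the norm of the target space.
\<close>

definition Gamma1_infinity ::
  "'a::euclidean_space set \<Rightarrow> ('a \<Rightarrow> real) \<Rightarrow> (real \<Rightarrow> 'a \<Rightarrow> real) set" where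
  "Gamma1_infinity \<Omega> w =
     {\<gamma>. (\<forall>t\<ge>0. \<gamma> t \<in> L1 \<Omega>) \<and>
         (\<forall>t\<ge>0. ((\<lambda>s. L1_norm \<Omega> (\<lambda>x. \<gamma> s x - \<gamma> t x)) \<longlongrightarrow> 0) (at t within {0..})) \<and>
         \<gamma> ` {0..} \<subseteq> W12_0 \<Omega> \<and>
         (AE x in lebesgue_on \<Omega>. \<gamma> 0 x = w x) \<and>
         ((\<lambda>t. L1_norm \<Omega> (\<lambda>x. \<gamma> t x - (- w x))) \<longlongrightarrow> 0) at_top}"

definition Gamma ::
  "'a::euclidean_space set \<Rightarrow> ('a \<Rightarrow> real) \<Rightarrow> (real \<Rightarrow> 'a \<Rightarrow> real) set" where
  "Gamma \<Omega> w =
     {\<gamma>. (\<forall>t\<in>{0..1}. \<gamma> t \<in> W12_0 \<Omega>) \<and>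
         (\<forall>t\<in>{0..1}. ((\<lambda>s. W12_0_norm \<Omega> (\<lambda>x. \<gamma> s x - \<gamma> t x)) \<longlongrightarrow> 0) (at t within {0..1})) \<and>
         (AE x in lebesgue_on \<Omega>. \<gamma> 0 x = w x) \<and>
         (AE x in lebesgue_on \<Omega>. \<gamma> 1 x = - w x)}"

text \<open>
  The energy may be unbounded along a path that is only \<open>L\<^sup>1\<close>-continuous, hence the extended reals.
  Along a path in \<^const>\<open>Gamma\<close> it is continuous on a compact interval, so that the maximum, taken
  literally as a greatest element, exists.
\<close>

definition nu_star ::
  "real \<Rightarrow> real \<Rightarrow> 'a::euclidean_space set \<Rightarrow> ('a \<Rightarrow> real) \<Rightarrow> ereal" where
  "nu_star q \<alpha> \<Omega> w =
     (INF \<gamma>\<in>Gamma1_infinity \<Omega> w. SUP \<phi>\<in>\<gamma> ` {0..}. ereal (energy q \<alpha> \<Omega> \<phi>))"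

definition Lambda_star ::
  "real \<Rightarrow> real \<Rightarrow> 'a::euclidean_space set \<Rightarrow> ('a \<Rightarrow> real) \<Rightarrow> ereal" where
  "Lambda_star q \<alpha> \<Omega> w =
     (INF \<gamma>\<in>Gamma \<Omega> w. ereal (GREATEST m. m \<in> energy q \<alpha> \<Omega> ` \<gamma> ` {0..1}))"

end

theory Submission
  imports Defs "HOL-Computational_Algebra.Polynomial"
begin

text \<open>
  A path in \<open>\<Gamma>\<close>, kept constant after time \<open>1\<close>, is \<open>L\<^sup>1\<close>-continuous by the Poincare inequality, so
  \<open>\<nu>\<^sup>* \<le> \<Lambda>\<^sup>*\<close>. Conversely, let \<open>\<gamma>\<close> be an \<open>L\<^sup>1\<close>-continuous path of energy at most \<open>m\<close>.
  Since \<open>q < 2\<close>, bounded energy bounds the Dirichlet integral, hence the \<open>L\<^sup>2\<close> norm. For two functions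
  bounded in this way and close in \<open>L\<^sup>1\<close>, the term \<open>\<integral>|\<cdot>|\<^sup>q\<close> is nearly constant on the segment
  joining them, while the Dirichlet integral is convex, so the energy exceeds \<open>m\<close> by at most \<open>\<epsilon>\<close>
  on that segment. Hence being joined by a \<open>W\<^sub>0\<^sup>1\<^sup>,\<^sup>2\<close>-continuous path of energy at most \<open>m + \<epsilon>\<close> is an
  equivalence relation that is locally trivial along \<open>\<gamma>\<close>, and connectedness of \<open>[0,\<infinity>)\<close>,
  together with one last segment from \<open>\<gamma>(t)\<close> to \<open>-w\<close> for large \<open>t\<close>, gives \<open>\<Lambda>\<^sup>* \<le> m + \<epsilon>\<close>.
\<close>

subsection \<open>Smooth test functions\<close>

text \<open>The given path need not be continuous for the gradient norm and its energy may jump, so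
  it is never regularized: only its points are kept, and they are joined by segments. What makes
  this work is uniformity. For fixed q, \<alpha> and \<Omega>, the L1 distance below which a segment
  is admissible depends only on m and \<epsilon>, because the energy bound alone controls the
  gradients. The excess \<epsilon> does not accumulate either: both ends of every segment are points
  of the path or -w, hence have energy at most m, so any number of segments may be concatenated and
  no subdivision of the half-line has to be chosen. Much of the development serves two facts. Since
  \<open>weak_gradient\<close> is a choice, its linearity, and with it the convexity of the
  Dirichlet integral, rests on uniqueness of weak gradients; this is why enough test functions are
  constructed to separate integrable functions. The Poincare inequality enters three times: for
  coercivity, for the L2 bound on sublevel sets, and for passing from gradient continuity to L1
  continuity.\<close>

lemma Ck_SucI:
  assumes "\<And>x. (f has_derivative f' x) (at x)" "\<And>i. i \<in> Basis \<Longrightarrow> Ck k (\<lambda>x. f' x i)"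
  shows "Ck (Suc k) f"
proof -
  have "frechet_derivative f (at x) = f' x" for x
    using frechet_derivative_at[OF assms(1)] by simp
  with assms show ?thesis
    by (auto simp: differentiable_on_def differentiable_def)
qed

lemma Ck_SucD:
  assumes "Ck (Suc k) f"
  shows "(f has_derivative frechet_derivative f (at x)) (at x)"
    and "i \<in> Basis \<Longrightarrow> Ck k (\<lambda>x. frechet_derivative f (at x) i)"
  using assms by (auto simp: differentiable_on_def frechet_derivative_works)

lemma Ck_Suc_imp_Ck: "Ck (Suc k) f \<Longrightarrow> Ck k f"
  by (induction k arbitrary: f) (auto intro: differentiable_imp_continuous_on)

lemma Ck_imp_continuous: "Ck k f \<Longrightarrow> continuous_on UNIV f"
  by (cases k) (auto intro: differentiable_imp_continuous_on)

lemma Ck_const: "Ck k (\<lambda>x. c)"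
proof (induction k arbitrary: c)
  case (Suc k)
  show ?case by (rule Ck_SucI[where f' = "\<lambda>_ _. 0"]) (auto intro: Suc)
qed auto

lemma Ck_add: "Ck k f \<Longrightarrow> Ck k g \<Longrightarrow> Ck k (\<lambda>x. f x + g x)"
proof (induction k arbitrary: f g)
  case (Suc k)
  show ?case
    by (rule Ck_SucI) (rule has_derivative_add[OF Ck_SucD(1)[OF Suc.prems(1)] Ck_SucD(1)[OF Suc.prems(2)]],
        auto intro!: Suc.IH Ck_SucD(2)[OF Suc.prems(1)] Ck_SucD(2)[OF Suc.prems(2)])
qed (auto intro: continuous_on_add)

lemma Ck_mult: "Ck k f \<Longrightarrow> Ck k g \<Longrightarrow> Ck k (\<lambda>x. f x * g x)"
proof (induction k arbitrary: f g)
  case (Suc k)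
  show ?case
    by (rule Ck_SucI) (rule has_derivative_mult[OF Ck_SucD(1)[OF Suc.prems(1)] Ck_SucD(1)[OF Suc.prems(2)]],
        auto intro!: Ck_add Suc.IH Ck_SucD(2)[OF Suc.prems(1)] Ck_SucD(2)[OF Suc.prems(2)]
          Ck_Suc_imp_Ck[OF Suc.prems(1)] Ck_Suc_imp_Ck[OF Suc.prems(2)])
qed (auto intro: continuous_on_mult)

lemma Ck_prod:
  assumes "finite A" "\<And>i. i \<in> A \<Longrightarrow> Ck k (f i)"
  shows "Ck k (\<lambda>x. \<Prod>i\<in>A. f i x)"
  using assms by (induction A rule: finite_induct) (auto intro: Ck_const Ck_mult)

lemma test_functionsD:
  assumes "\<psi> \<in> test_functions \<Omega>"
  shows "Ck k \<psi>" "\<psi> x \<noteq> 0 \<Longrightarrow> x \<in> \<Omega>"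
  using assms closure_subset[of "{x. \<psi> x \<noteq> 0}"] by (auto simp: test_functions_def)

lemma test_functionsI:
  assumes "\<And>k. Ck k \<psi>" "compact K" "K \<subseteq> \<Omega>" "\<And>x. x \<notin> K \<Longrightarrow> \<psi> x = 0"
  shows "\<psi> \<in> test_functions \<Omega>"
proof -
  have "closure {x. \<psi> x \<noteq> 0} \<subseteq> K"
    using assms by (intro closure_minimal) (auto intro: compact_imp_closed)
  with assms show ?thesis
    by (auto simp: test_functions_def intro: compact_closure[THEN iffD2] bounded_subset[OF compact_imp_bounded])
qed

lemma test_functions_add:
  assumes f: "f \<in> test_functions \<Omega>" and g: "g \<in> test_functions \<Omega>"
  shows "(\<lambda>x. f x + g x) \<in> test_functions \<Omega>"
proof (rule test_functionsI[where K = "closure {x. f x \<noteq> 0} \<union> closure {x. g x \<noteq> 0}"])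
  show "f x + g x = 0" if "x \<notin> closure {x. f x \<noteq> 0} \<union> closure {x. g x \<noteq> 0}" for x
    using that closure_subset[of "{x. f x \<noteq> 0}"] closure_subset[of "{x. g x \<noteq> 0}"] by fastforce
qed (use f g in \<open>auto simp: test_functions_def intro: Ck_add\<close>)

lemma test_functions_mult:
  assumes f: "f \<in> test_functions \<Omega>" and g: "\<And>k. Ck k g"
  shows "(\<lambda>x. g x * f x) \<in> test_functions \<Omega>"
proof (rule test_functionsI[where K = "closure {x. f x \<noteq> 0}"])
  show "g x * f x = 0" if "x \<notin> closure {x. f x \<noteq> 0}" for x
    using that closure_subset[of "{x. f x \<noteq> 0}"] by auto
qed (use f g in \<open>auto simp: test_functions_def intro: Ck_mult\<close>)

text \<open>This family contains \<open>exp (-1/t)\<close> and is closed under differentiation, so that smoothness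
  is a single induction.\<close>

definition flat_poly :: "real poly \<Rightarrow> real \<Rightarrow> real" where
  "flat_poly p t = (if t > 0 then poly p (1/t) * exp (-1/t) else 0)"

lemma poly_times_exp_tendsto_0:
  fixes p :: "real poly"
  shows "((\<lambda>u. poly p u * exp (- u)) \<longlongrightarrow> 0) at_top"
proof -
  have "((\<lambda>u::real. u ^ n * exp (- u)) \<longlongrightarrow> 0) at_top" for n
    using tendsto_power_div_exp_0[of n] by (simp add: exp_minus field_simps)
  then have "((\<lambda>u::real. \<Sum>n\<le>degree p. coeff p n * (u ^ n * exp (- u))) \<longlongrightarrow> (\<Sum>n\<le>degree p. coeff p n * 0)) at_top"
    by (intro tendsto_intros)
  then show ?thesis by (simp add: poly_altdef sum_distrib_right mult.assoc)
qed

text \<open>With u = 1/t one has du/dt = -u^2, so p(u) exp(-u) has derivative u^2 (p(u) - p'(u))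
  exp(-u). At t = 0 exponential decay beats every power of u.\<close>

lemma flat_poly_deriv:
  "(flat_poly p has_real_derivative flat_poly (monom 1 2 * (p - pderiv p)) t) (at t)"
proof -
  consider "t > 0" | "t = 0" | "t < 0" by linarith
  then show ?thesis
  proof cases
    case 1
    have "((\<lambda>t. poly p (1/t) * exp (-1/t)) has_real_derivative
        flat_poly (monom 1 2 * (p - pderiv p)) t) (at t)"
      using 1 by (auto intro!: derivative_eq_intros DERIV_chain2[of "poly p"] poly_DERIV
          simp: flat_poly_def poly_monom field_simps power2_eq_square)
    then show ?thesis
      by (rule has_field_derivative_transform_within_open[of _ _ _ "{0<..}"]) (use 1 in \<open>auto simp: flat_poly_def\<close>)
  next
    case 3
    have "((\<lambda>t::real. 0::real) has_real_derivative 0) (at t)" by simp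
    then have "(flat_poly p has_real_derivative 0) (at t)"
      by (rule has_field_derivative_transform_within_open[of _ _ _ "{..<0}"]) (use 3 in \<open>auto simp: flat_poly_def\<close>)
    with 3 show ?thesis by (simp add: flat_poly_def)
  next
    case 2
    \<comment> \<open>The difference quotient at 0 from the right is u p(u) exp(-u) with u = 1/h;
      \<open>pCons 0 p\<close> supplies the extra factor u.\<close>
    have "((\<lambda>u. poly (pCons 0 p) u * exp (- u)) \<longlongrightarrow> 0) at_top"
      by (rule poly_times_exp_tendsto_0)
    then have "((\<lambda>h. poly (pCons 0 p) (inverse h) * exp (- inverse h)) \<longlongrightarrow> 0) (at_right 0)"
      by (rule filterlim_compose) (rule filterlim_inverse_at_top_right)
    then have "((\<lambda>h. flat_poly p h / h) \<longlongrightarrow> 0) (at_right 0)"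
      by (rule Lim_transform_eventually)
        (auto simp: eventually_at_right_field flat_poly_def field_simps intro!: exI[of _ 1])
    moreover have "((\<lambda>h. flat_poly p h / h) \<longlongrightarrow> 0) (at_left 0)"
      by (rule Lim_transform_eventually[OF tendsto_const])
        (auto simp: eventually_at_left_field flat_poly_def intro!: exI[of _ "-1"])
    ultimately have "((\<lambda>h. flat_poly p h / h) \<longlongrightarrow> 0) (at 0)"
      by (simp add: filterlim_split_at)
    then show ?thesis using 2 by (simp add: has_field_derivative_iff flat_poly_def)
  qed
qed

text \<open>Affine arguments are what the two faces of a box orthogonal to a basis vector require.
  Differentiation changes the polynomial, hence the generalization over p.\<close>

lemma Ck_flat_poly_affine: "Ck k (\<lambda>x::'a::euclidean_space. flat_poly p (c * (x \<bullet> v) + d))"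
proof (induction k arbitrary: p)
  case 0
  have "continuous_on UNIV (flat_poly p)"
    using flat_poly_deriv[of p] by (intro DERIV_continuous_on) (auto intro: has_field_derivative_at_within)
  then show ?case
    by (auto intro!: continuous_on_compose2[of UNIV "flat_poly p"] continuous_intros)
next
  case (Suc k)
  let ?q = "monom 1 2 * (p - pderiv p)"
  show ?case
  proof (rule Ck_SucI)
    show "((\<lambda>x. flat_poly p (c * (x \<bullet> v) + d)) has_derivative
        (\<lambda>y. flat_poly ?q (c * (x \<bullet> v) + d) * (c * (y \<bullet> v)))) (at x)" for x :: 'a
    proof -
      have "((\<lambda>x. c * (x \<bullet> v) + d) has_derivative (\<lambda>y. c * (y \<bullet> v))) (at x)"
        by (auto intro!: derivative_eq_intros)
      from has_derivative_compose[OF this flat_poly_deriv[of p, THEN has_field_derivative_imp_has_derivative]]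
      show ?thesis by simp
    qed
  qed (auto intro!: Ck_mult Ck_const Suc)
qed

subsection \<open>Integration of partial derivatives and the fundamental lemma\<close>

text \<open>Difference quotients in direction i have integral 0 by translation invariance of
  Lebesgue measure. They converge pointwise to the partial derivative and, by the mean value theorem
  and the bounded support, are dominated by a constant on a ball.\<close>

lemma integral_partial_derivative:
  fixes f :: "'a::euclidean_space \<Rightarrow> real"
  assumes df: "\<And>x. (f has_derivative f' x) (at x)"
    and cont: "continuous_on UNIV (\<lambda>x. f' x i)" and i: "i \<in> Basis"
    and bdd: "bounded {x. f x \<noteq> 0}"
  shows "(LINT x|lborel. f' x i) = 0"
proof -
  obtain R where R: "\<And>x. f x \<noteq> 0 \<Longrightarrow> norm x \<le> R"
    using bdd by (auto simp: bounded_iff)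
  have contf: "continuous_on UNIV f"
    using df by (meson has_derivative_at_withinI has_derivative_continuous_on)
  have out: "f' x i = 0" if "R < norm x" for x
  proof -
    have "(f has_derivative (\<lambda>_. 0)) (at x)"
      by (rule has_derivative_transform_within_open[of "\<lambda>_. 0" _ _ _ "- cball 0 R"]) (use that R in force)+
    then show ?thesis using has_derivative_unique df by metis
  qed
  have "bounded ((\<lambda>x. f' x i) ` cball 0 R)"
    by (intro compact_imp_bounded compact_continuous_image continuous_on_subset[OF cont]) auto
  then obtain B0 where B0: "\<And>x. norm x \<le> R \<Longrightarrow> \<bar>f' x i\<bar> \<le> B0"
    unfolding bounded_iff by fastforce
  \<comment> \<open>Outside the ball the derivative is 0, and \<open>B0\<close> may be negative when
    \<open>cball 0 R\<close> is empty.\<close>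
  define B where "B = max B0 0"
  have B: "\<bar>f' x i\<bar> \<le> B" for x
    using B0[of x] out[of x] by (cases "norm x \<le> R") (auto simp: B_def)
  \<comment> \<open>Steps of length at most 1 keep the supports of all quotients inside the ball of
    radius R + 1.\<close>
  define h where "h n = inverse (real (Suc n))" for n
  have h: "0 < h n" "h n \<le> 1" for n by (auto simp: h_def field_simps)
  have h0: "h \<longlonglongrightarrow> 0" unfolding h_def by (rule LIMSEQ_inverse_real_of_nat)
  define g where "g n x = (f (h n *\<^sub>R i + x) - f x) / h n" for n x
  have line: "((\<lambda>t. f (t *\<^sub>R i + x)) has_real_derivative f' (t *\<^sub>R i + x) i) (at t)" for x t
  proof -
    have "((\<lambda>t. t *\<^sub>R i + x) has_derivative (\<lambda>s. s *\<^sub>R i)) (at t)"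
      by (auto intro!: derivative_eq_intros)
    from has_derivative_compose[OF this df]
    have "((\<lambda>t. f (t *\<^sub>R i + x)) has_derivative (\<lambda>s. f' (t *\<^sub>R i + x) (s *\<^sub>R i))) (at t)" .
    moreover have "f' (t *\<^sub>R i + x) (s *\<^sub>R i) = f' (t *\<^sub>R i + x) i * s" for s
      using linear_cmul[OF has_derivative_linear[OF df], of "t *\<^sub>R i + x" s i] by simp
    ultimately show ?thesis by (simp add: has_field_derivative_def)
  qed
  have lim: "(\<lambda>n. g n x) \<longlonglongrightarrow> f' x i" for x
  proof -
    have "((\<lambda>t. (f (t *\<^sub>R i + x) - f x) / t) \<longlongrightarrow> f' x i) (at 0)"
      using line[of x 0] by (simp add: has_field_derivative_iff)
    moreover have "filterlim h (at 0) sequentially"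
      using h0 h by (auto simp: filterlim_at less_le intro!: always_eventually)
    ultimately show ?thesis unfolding g_def by (rule filterlim_compose)
  qed
  have bound: "\<bar>g n x\<bar> \<le> indicator (cball 0 (R + 1)) x * B" for n x
  proof (cases "norm x \<le> R + 1")
    case True
    obtain z where "f (h n *\<^sub>R i + x) - f (0 *\<^sub>R i + x) = (h n - 0) * f' (z *\<^sub>R i + x) i"
      using MVT2[OF h(1)[of n], of "\<lambda>t. f (t *\<^sub>R i + x)" "\<lambda>t. f' (t *\<^sub>R i + x) i"] line by blast
    then have "g n x = f' (z *\<^sub>R i + x) i"
      using h(1)[of n] by (simp add: g_def)
    with True B show ?thesis by simp
  next
    case False
    have "norm x \<le> norm (h n *\<^sub>R i + x) + norm (h n *\<^sub>R i)"
      using norm_triangle_ineq4[of "h n *\<^sub>R i + x" "h n *\<^sub>R i"] by simp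
    with h[of n] i have "norm x \<le> norm (h n *\<^sub>R i + x) + 1" by simp
    with False have "f x = 0" "f (h n *\<^sub>R i + x) = 0" using R[of x] R[of "h n *\<^sub>R i + x"] by force+
    then show ?thesis using False by (simp add: g_def)
  qed
  have [measurable]: "f \<in> borel_measurable borel" "(\<lambda>x. f' x i) \<in> borel_measurable borel"
    using contf cont by (auto intro: borel_measurable_continuous_onI)
  have [measurable]: "g n \<in> borel_measurable borel" for n unfolding g_def by measurable
  have w: "integrable lborel (\<lambda>x::'a. indicator (cball 0 (R + 1)) x * B)"
    using borel_integrable_compact[of "cball 0 (R + 1)" "\<lambda>_. B"] by (simp add: scaleR_conv_of_real)
  have L: "(\<lambda>n. integral\<^sup>L lborel (g n)) \<longlonglongrightarrow> (LINT x|lborel. f' x i)"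
    by (rule integral_dominated_convergence[of _ lborel g "\<lambda>x. indicator (cball 0 (R + 1)) x * B"])
      (use w lim bound in auto)
  have intf: "integrable lborel f"
  proof -
    have "(\<lambda>x. indicator (cball 0 R) x *\<^sub>R f x) = f"
      using R by (fastforce simp: indicator_def)
    then show ?thesis
      using borel_integrable_compact[of "cball 0 R" f] continuous_on_subset[OF contf] by simp
  qed
  have "integral\<^sup>L lborel (g n) = 0" for n
  proof -
    let ?T = "distr lborel borel ((+) (h n *\<^sub>R i))"
    have T: "?T = lborel" by (rule lborel_distr_plus)
    have "integrable ?T f" "integral\<^sup>L ?T f = integral\<^sup>L lborel f" using intf by (simp_all only: T)
    then have "integrable lborel (\<lambda>x. f (h n *\<^sub>R i + x))"
      "(LINT x|lborel. f (h n *\<^sub>R i + x)) = integral\<^sup>L lborel f"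
      by (simp_all add: integrable_distr_eq integral_distr)
    with intf show ?thesis unfolding g_def[abs_def] by simp
  qed
  with L show "(LINT x|lborel. f' x i) = 0"
    using LIMSEQ_unique[OF L] by (simp add: LIMSEQ_const_iff)
qed

lemma integral_lebesgue_on_supported:
  fixes f :: "'a::euclidean_space \<Rightarrow> real"
  assumes "open \<Omega>" "f \<in> borel_measurable borel" "\<And>x. x \<notin> \<Omega> \<Longrightarrow> f x = 0"
  shows "(LINT x|lebesgue_on \<Omega>. f x) = (LINT x|lborel. f x)"
proof -
  have eq: "(\<lambda>x. indicator \<Omega> x *\<^sub>R f x) = f"
    using assms(3) by (intro ext) (auto simp: indicator_def)
  have O: "\<Omega> \<inter> space lebesgue \<in> sets lebesgue" using \<open>open \<Omega>\<close> by simp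
  show "(LINT x|lebesgue_on \<Omega>. f x) = (LINT x|lborel. f x)"
    using assms(2) unfolding integral_restrict_space[OF O] eq by (simp add: integral_completion)
qed

text \<open>Take the product over all coordinates of e(n(x_i - a_i)) e(n(b_i - x_i)), where e =
  \<open>flat_poly 1\<close>, that is exp(-1/t) for t > 0. It vanishes off the open box, and inside
  it every factor tends to 1. Dilating one smooth step takes the place of mollifying the
  indicator.\<close>

lemma box_indicator_limit_of_test_functions:
  fixes a b :: "'a::euclidean_space"
  assumes sub: "cbox a b \<subseteq> \<Omega>"
  obtains \<psi> where "\<And>n. \<psi> n \<in> test_functions \<Omega>" "\<And>n x. \<bar>\<psi> n x\<bar> \<le> 1"
    "\<And>x. (\<lambda>n. \<psi> n x) \<longlonglongrightarrow> indicator (box a b) x"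
proof
  let ?e = "flat_poly 1"
  define \<psi> :: "nat \<Rightarrow> 'a \<Rightarrow> real" where
    "\<psi> n x = (\<Prod>i\<in>Basis. ?e (real n * (x \<bullet> i) + (- real n * (a \<bullet> i)))
        * ?e ((- real n) * (x \<bullet> i) + real n * (b \<bullet> i)))" for n x
  have e: "0 \<le> ?e t" "?e t \<le> 1" "t \<le> 0 \<Longrightarrow> ?e t = 0" for t by (auto simp: flat_poly_def)
  have zero: "\<psi> n x = 0" if "x \<notin> box a b" for n x
  proof -
    obtain i where i: "i \<in> Basis" "\<not> (a \<bullet> i < x \<bullet> i \<and> x \<bullet> i < b \<bullet> i)"
      using \<open>x \<notin> box a b\<close> by (auto simp: box_def)
    then have "real n * (x \<bullet> i) + (- real n * (a \<bullet> i)) \<le> 0 \<or> (- real n) * (x \<bullet> i) + real n * (b \<bullet> i) \<le> 0"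
      by (auto simp: mult_left_mono not_less)
    then have "?e (real n * (x \<bullet> i) + (- real n * (a \<bullet> i)))
        * ?e ((- real n) * (x \<bullet> i) + real n * (b \<bullet> i)) = 0"
      using e(3) by fastforce
    with i(1) show ?thesis unfolding \<psi>_def by (intro prod_zero finite_Basis) (rule bexI)
  qed
  show "\<psi> n \<in> test_functions \<Omega>" for n
  proof (rule test_functionsI[OF _ _ sub])
    show "Ck k (\<psi> n)" for k
      unfolding \<psi>_def by (intro Ck_prod Ck_mult Ck_flat_poly_affine) auto
    show "\<psi> n x = 0" if "x \<notin> cbox a b" for x
      using zero that box_subset_cbox by blast
  qed auto
  show "\<bar>\<psi> n x\<bar> \<le> 1" for n x
    unfolding \<psi>_def abs_prod by (intro prod_le_1) (auto simp: abs_mult e intro!: mult_le_one)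
  show "(\<lambda>n. \<psi> n x) \<longlonglongrightarrow> indicator (box a b) x" for x
  proof (cases "x \<in> box a b")
    case False
    then show ?thesis using zero by simp
  next
    case True
    have lim: "(\<lambda>n. ?e (real n * c)) \<longlonglongrightarrow> 1" if "c > 0" for c
    proof (rule Lim_transform_eventually)
      have "(\<lambda>n. exp (- ((1/c) * inverse (real n)))) \<longlonglongrightarrow> exp (- ((1/c) * 0))"
        by (intro tendsto_intros lim_inverse_n)
      then show "(\<lambda>n. exp (- ((1/c) * inverse (real n)))) \<longlonglongrightarrow> 1" by simp
      \<comment> \<open>At n = 0 the two sides differ: the left one is 1, the right one 0.\<close>
      show "\<forall>\<^sub>F n in sequentially. exp (- ((1/c) * inverse (real n))) = ?e (real n * c)"
        using eventually_gt_at_top[of 0] by eventually_elim (use that in \<open>auto simp: flat_poly_def field_simps\<close>)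
    qed
    have "(\<lambda>n. \<psi> n x) \<longlonglongrightarrow> (\<Prod>i\<in>(Basis::'a set). 1 * 1)"
      unfolding \<psi>_def
    proof (intro tendsto_prod tendsto_mult)
      fix i :: 'a assume "i \<in> Basis"
      with True have "x \<bullet> i - a \<bullet> i > 0" "b \<bullet> i - x \<bullet> i > 0" by (auto simp: box_def)
      from this[THEN lim]
      show "(\<lambda>n. ?e (real n * (x \<bullet> i) + (- real n * (a \<bullet> i)))) \<longlonglongrightarrow> 1"
        "(\<lambda>n. ?e ((- real n) * (x \<bullet> i) + real n * (b \<bullet> i))) \<longlonglongrightarrow> 1"
        by (simp_all add: algebra_simps)
    qed
    with True show ?thesis by simp
  qed
qed

text \<open>The Borel sets over which the cut-off function f has integral 0 include the boxes, an
  intersection-stable generator, and are closed under complements and countable disjoint unions; so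
  they are all Borel sets. The hypothesis speaks of closed boxes because these are the supports of
  the approximating test functions.\<close>

lemma AE_zero_of_box_integrals:
  fixes g :: "'a::euclidean_space \<Rightarrow> real"
  assumes g: "integrable lborel g"
    and box: "\<And>a b. cbox a b \<subseteq> cbox c d \<Longrightarrow> (LINT x:box a b|lborel. g x) = 0"
  shows "AE x in lborel. x \<in> box c d \<longrightarrow> g x = 0"
proof -
  define f where "f x = indicator (box c d) x *\<^sub>R g x" for x
  have f: "integrable lborel f"
    unfolding f_def by (intro integrable_mult_indicator g) auto
  have setf: "set_integrable lborel A f" if "A \<in> sets borel" for A
    unfolding set_integrable_def using f that by (intro integrable_mult_indicator) auto
  have inter: "(LINT x:box a b|lborel. f x) = 0" for a b
  proof -
    \<comment> \<open>The same corners serve for the open and the closed boxes, which provides the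
      inclusion that \<open>box\<close> asks for.\<close>
    obtain l u where lu: "box a b \<inter> box c d = box l u" "cbox a b \<inter> cbox c d = cbox l u"
      using box_Int_box[of a b c d] Int_interval[of a b c d] by auto
    have "(LINT x:box a b|lborel. f x) = (LINT x:box l u|lborel. g x)"
      unfolding set_lebesgue_integral_def f_def lu(1)[symmetric]
      by (simp add: indicator_inter_arith mult.assoc)
    also have "\<dots> = 0" using lu(2) by (intro box) auto
    finally show ?thesis .
  qed
  have "(LINT x:A|lborel. f x) = 0" if "A \<in> sets borel" for A
  proof -
    have "Int_stable (range (\<lambda>(a, b). box a b :: 'a set))"
      by (auto simp: Int_stable_def box_Int_box)
    moreover have "range (\<lambda>(a, b). box a b :: 'a set) \<subseteq> Pow UNIV" by simp
    moreover have "A \<in> sigma_sets UNIV (range (\<lambda>(a, b). box a b :: 'a set))"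
      using that unfolding borel_eq_box by simp
    ultimately show ?thesis
    proof (induction rule: sigma_sets_induct_disjoint)
      case (basic A)
      then show ?case using inter by auto
    next
      case empty
      show ?case by (simp add: set_lebesgue_integral_def)
    next
      case (compl A)
      then have A: "A \<in> sets borel" by (simp add: borel_eq_box)
      \<comment> \<open>Since f vanishes off the box, its total integral is itself a box integral;
        the complement case depends on this.\<close>
      have "integral\<^sup>L lborel f = (LINT x:box c d|lborel. f x)"
        unfolding set_lebesgue_integral_def by (intro Bochner_Integration.integral_cong) (auto simp: f_def indicator_def)
      then have "integral\<^sup>L lborel f = 0" using inter by simp
      moreover have "integral\<^sup>L lborel f = (LINT x:(UNIV - A) \<union> A|lborel. f x)"
        by (simp add: set_lebesgue_integral_def)
      moreover have "\<dots> = (LINT x:UNIV - A|lborel. f x) + (LINT x:A|lborel. f x)"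
        using A by (intro set_integral_Un setf) auto
      ultimately show ?case using compl.IH by simp
    next
      case (union F)
      then have F: "F i \<in> sets borel" for i by (auto simp: borel_eq_box subset_eq)
      have "(LINT x:(\<Union>i. F i)|lborel. f x) = (\<Sum>i. (LINT x:F i|lborel. f x))"
        using F union.hyps by (intro lebesgue_integral_countable_add setf) (auto simp: disjoint_family_on_def)
      then show ?case using union.IH by simp
    qed
  qed
  then have "AE x in lborel. f x = 0"
    by (intro sigma_finite_measure.density_zero[OF sigma_finite_lborel] f) auto
  then show ?thesis by eventually_elim (auto simp: f_def)
qed

text \<open>The fundamental lemma of the calculus of variations. Limits of test functions give
  vanishing integrals over open boxes whose closed versions lie in \<Omega>, and \<Omega> is a
  countable union of closed boxes.\<close>

lemma AE_zero_of_test_functions: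
  fixes g :: "'a::euclidean_space \<Rightarrow> real"
  assumes \<Omega>: "open \<Omega>" and g: "integrable (lebesgue_on \<Omega>) g"
    and test: "\<And>\<psi>. \<psi> \<in> test_functions \<Omega> \<Longrightarrow> (LINT x|lebesgue_on \<Omega>. g x * \<psi> x) = 0"
  shows "AE x in lebesgue_on \<Omega>. g x = 0"
proof -
  have O: "\<Omega> \<inter> space lebesgue \<in> sets lebesgue" using \<Omega> by simp
  define k where "k x = indicator \<Omega> x *\<^sub>R g x" for x
  have k: "integrable lebesgue k"
    using g by (simp add: integrable_restrict_space[OF O] k_def[abs_def])
  \<comment> \<open>The box argument lives on \<open>lborel\<close>, whereas the extension of g by
    zero is only Lebesgue measurable; a Borel representative bridges the two.\<close>
  obtain k' where k': "k' \<in> borel_measurable lborel" "AE x in lborel. k x = k' x"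
    using completion_ex_borel_measurable_real[OF borel_measurable_integrable[OF k]] by auto
  have [measurable]: "k' \<in> borel_measurable borel" using k'(1) by simp
  have AEk: "AE x in lebesgue. k x = k' x" using k'(2) by (rule AE_completion)
  have "integrable lebesgue k'"
    using k AEk k' by (subst integrable_cong_AE[of k' _ k]) (auto simp: measurable_completion)
  then have intk': "integrable lborel k'" by (simp add: integrable_completion)
  have test': "(LINT x|lborel. k' x * \<psi> x) = 0" if "\<psi> \<in> test_functions \<Omega>" for \<psi>
  proof -
    have [measurable]: "\<psi> \<in> borel_measurable borel"
      using Ck_imp_continuous[OF test_functionsD(1)[OF that]] by (rule borel_measurable_continuous_onI)
    have "(LINT x|lborel. k' x * \<psi> x) = (LINT x|lebesgue. k' x * \<psi> x)"
      by (rule integral_completion[symmetric]) simp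
    also have "\<dots> = (LINT x|lebesgue. k x * \<psi> x)"
    proof (rule integral_cong_AE)
      show "(\<lambda>x. k' x * \<psi> x) \<in> borel_measurable lebesgue" by (intro measurable_completion) simp
      have "\<psi> \<in> borel_measurable lebesgue" by (intro measurable_completion) simp
      then show "(\<lambda>x. k x * \<psi> x) \<in> borel_measurable lebesgue"
        using borel_measurable_integrable[OF k] by (rule borel_measurable_times[rotated])
    qed (use AEk in eventually_elim, simp)
    also have "\<dots> = (LINT x|lebesgue_on \<Omega>. g x * \<psi> x)"
      by (subst integral_restrict_space[OF O]) (simp add: k_def mult_ac)
    finally show ?thesis using test[OF that] by simp
  qed
  have box: "(LINT x:box a b|lborel. k' x) = 0" if ab: "cbox a b \<subseteq> \<Omega>" for a b
  proof -
    obtain \<psi> where \<psi>: "\<And>n. \<psi> n \<in> test_functions \<Omega>" "\<And>n x. \<bar>\<psi> n x\<bar> \<le> 1"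
      "\<And>x. (\<lambda>n. \<psi> n x) \<longlonglongrightarrow> indicator (box a b) x"
      using box_indicator_limit_of_test_functions[OF ab] by blast
    have [measurable]: "\<psi> n \<in> borel_measurable borel" for n
      using Ck_imp_continuous[OF test_functionsD(1)[OF \<psi>(1)]] by (rule borel_measurable_continuous_onI)
    have "(\<lambda>n. LINT x|lborel. k' x * \<psi> n x) \<longlonglongrightarrow> (LINT x|lborel. k' x * indicator (box a b) x)"
    proof (rule integral_dominated_convergence[where w = "\<lambda>x. \<bar>k' x\<bar>"])
      show "AE x in lborel. (\<lambda>n. k' x * \<psi> n x) \<longlonglongrightarrow> k' x * indicator (box a b) x"
        by (intro AE_I2 tendsto_intros \<psi>(3))
      show "AE x in lborel. norm (k' x * \<psi> n x) \<le> \<bar>k' x\<bar>" for n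
        using \<psi>(2) by (intro AE_I2) (auto simp: abs_mult mult_left_le)
    qed (use intk' in auto)
    then show ?thesis
      using test'[OF \<psi>(1)] by (simp add: set_lebesgue_integral_def LIMSEQ_const_iff mult.commute)
  qed
  obtain \<D> where \<D>: "countable \<D>" "\<D> \<subseteq> Pow \<Omega>" "\<And>X. X \<in> \<D> \<Longrightarrow> \<exists>a b. X = cbox a b" "\<Union>\<D> = \<Omega>"
    using open_countable_Union_open_cbox[OF \<Omega>] by metis
  have "AE x in lebesgue. x \<in> X \<longrightarrow> k' x = 0" if "X \<in> \<D>" for X
  proof -
    from \<D>(3)[OF that] obtain a b where X: "X = cbox a b" by blast
    with \<D>(2) that have "cbox a b \<subseteq> \<Omega>" by auto
    then have "AE x in lborel. x \<in> box a b \<longrightarrow> k' x = 0"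
      by (intro AE_zero_of_box_integrals intk' box) auto
    then have "AE x in lebesgue. x \<in> box a b \<longrightarrow> k' x = 0" by (rule AE_completion)
    \<comment> \<open>The cover consists of closed boxes but vanishing is known on open ones; the
      faces are null.\<close>
    moreover have "AE x in lebesgue. x \<notin> cbox a b - box a b"
      using negligible_frontier_interval[of a b] unfolding negligible_iff_null_sets by (rule AE_not_in)
    ultimately show ?thesis by eventually_elim (auto simp: X)
  qed
  then have "AE x in lebesgue. \<forall>X\<in>\<D>. x \<in> X \<longrightarrow> k' x = 0"
    unfolding AE_ball_countable[OF \<D>(1)] by blast
  with AEk have "AE x in lebesgue. x \<in> \<Omega> \<longrightarrow> g x = 0"
    by eventually_elim (use \<D>(4) in \<open>auto simp: k_def indicator_def split: if_splits\<close>)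
  then show ?thesis using \<Omega> by (subst AE_restrict_space_iff) auto
qed

subsection \<open>Weak gradients\<close>

lemma test_function_derivative:
  assumes "\<psi> \<in> test_functions \<Omega>"
  shows "(\<psi> has_derivative frechet_derivative \<psi> (at x)) (at x)"
    and "i \<in> Basis \<Longrightarrow> continuous_on UNIV (\<lambda>x. frechet_derivative \<psi> (at x) i)"
    and "x \<notin> \<Omega> \<Longrightarrow> frechet_derivative \<psi> (at x) i = 0"
proof -
  note C = test_functionsD(1)[OF assms, of "Suc 0"]
  show D: "(\<psi> has_derivative frechet_derivative \<psi> (at x)) (at x)" for x
    by (rule Ck_SucD(1)[OF C])
  show "i \<in> Basis \<Longrightarrow> continuous_on UNIV (\<lambda>x. frechet_derivative \<psi> (at x) i)"
    by (rule Ck_imp_continuous[OF Ck_SucD(2)[OF C]])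
  show "frechet_derivative \<psi> (at x) i = 0" if "x \<notin> \<Omega>"
  proof -
    have x: "x \<in> - closure {x. \<psi> x \<noteq> 0}" using that assms by (auto simp: test_functions_def)
    have "(\<psi> has_derivative (\<lambda>_. 0)) (at x)"
      by (rule has_derivative_transform_within_open[of "\<lambda>_. 0" _ _ _ "- closure {x. \<psi> x \<noteq> 0}"])
        (use x closure_subset[of "{x. \<psi> x \<noteq> 0}"] in auto)
    then show ?thesis using has_derivative_unique[OF D] by metis
  qed
qed

lemma bounded_of_continuous_support:
  fixes f :: "'a::euclidean_space \<Rightarrow> real"
  assumes f: "continuous_on UNIV f" "bounded {x. f x \<noteq> 0}"
  obtains B where "\<And>x. \<bar>f x\<bar> \<le> B"
proof -
  have "compact (f ` closure {x. f x \<noteq> 0})"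
    using f by (intro compact_continuous_image) (auto intro: continuous_on_subset)
  from compact_imp_bounded[OF this]
  obtain B where B: "\<And>x. x \<in> closure {x. f x \<noteq> 0} \<Longrightarrow> \<bar>f x\<bar> \<le> B" unfolding bounded_iff by fastforce
  have "\<bar>f x\<bar> \<le> max B 0" for x
    using B[of x] closure_subset[of "{x. f x \<noteq> 0}"] by (cases "f x = 0") auto
  then show ?thesis by (rule that)
qed

section \<open>Elementary inequalities for squared norms\<close>

lemma norm_add_squared_le:
  fixes a b :: "'a::real_inner"
  shows "(norm (a + b))\<^sup>2 \<le> 2 * (norm a)\<^sup>2 + 2 * (norm b)\<^sup>2"
  using zero_le_power2[of "norm (a - b)"]
  by (simp add: power2_norm_eq_inner inner_simps inner_commute)

lemma norm_convex_comb_squared_le: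
  fixes a b :: "'a::real_inner"
  assumes "0 \<le> s" "s \<le> 1"
  shows "(norm ((1 - s) *\<^sub>R a + s *\<^sub>R b))\<^sup>2 \<le> (1 - s) * (norm a)\<^sup>2 + s * (norm b)\<^sup>2"
proof -
  have "(1 - s) * (norm a)\<^sup>2 + s * (norm b)\<^sup>2 - (norm ((1 - s) *\<^sub>R a + s *\<^sub>R b))\<^sup>2
      = s * (1 - s) * (norm (a - b))\<^sup>2"
    by (simp add: power2_norm_eq_inner inner_simps inner_commute) (simp add: algebra_simps)
  also have "\<dots> \<ge> 0" using assms by simp
  finally show ?thesis by simp
qed

text \<open>Expand |b + c|^2 - |b|^2 with c = a - b and split the cross term by Young's inequality
  with weight \<delta>. Integrated, this gives continuity of the Dirichlet integral without a
  triangle inequality for the L2 norm.\<close>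

lemma norm_squared_diff_le:
  fixes a b :: "'a::real_inner"
  assumes "\<delta> > 0"
  shows "\<bar>(norm a)\<^sup>2 - (norm b)\<^sup>2\<bar> \<le> (1 + 1 / \<delta>) * (norm (a - b))\<^sup>2 + \<delta> * (norm b)\<^sup>2"
proof -
  define c where "c = a - b"
  have a: "a = b + c" by (simp add: c_def)
  have "2 * (norm b * norm c) \<le> (1 / \<delta>) * (norm c)\<^sup>2 + \<delta> * (norm b)\<^sup>2"
  proof -
    have "0 \<le> (norm c - \<delta> * norm b)\<^sup>2 / \<delta>" using assms by simp
    then show ?thesis using assms by (simp add: power2_eq_square field_simps)
  qed
  moreover have "\<bar>b \<bullet> c\<bar> \<le> norm b * norm c" by (rule Cauchy_Schwarz_ineq2)
  moreover have "(norm a)\<^sup>2 - (norm b)\<^sup>2 = 2 * (b \<bullet> c) + (norm c)\<^sup>2"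
    by (simp add: a power2_norm_eq_inner inner_simps inner_commute)
  ultimately show ?thesis
    unfolding c_def[symmetric] using zero_le_power2[of "norm c"] by (simp only: distrib_right mult_1 abs_le_iff) linarith
qed

section \<open>Square-integrable functions and weak gradients on a bounded open set\<close>

locale bounded_open =
  fixes \<Omega> :: "'a::euclidean_space set"
  assumes open_dom: "open \<Omega>" and bounded_dom: "bounded \<Omega>"
begin

abbreviation "M \<equiv> lebesgue_on \<Omega>"

text \<open>Finite measure makes constants integrable, which underlies every bound of the form
  constant plus square, starting with the inclusion of L2 in L1.\<close>

sublocale finite_measure M
  using open_dom bounded_dom by (intro finite_measure_lebesgue_on lmeasurable_open)

lemma borel_measurable_domain:
  "f \<in> borel_measurable borel \<Longrightarrow> f \<in> borel_measurable M"
  by (intro measurable_restrict_space1 measurable_completion) simp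

lemma L2I:
  fixes f :: "'a \<Rightarrow> 'b::euclidean_space"
  assumes "f \<in> borel_measurable M" "integrable M g" "\<And>x. (norm (f x))\<^sup>2 \<le> g x"
  shows "f \<in> L2 \<Omega>"
proof -
  have "norm ((norm (f x))\<^sup>2) \<le> norm (g x)" for x
    using assms(3)[of x] by simp
  with assms show ?thesis
    unfolding L2_def by (auto intro!: Bochner_Integration.integrable_bound[OF assms(2)])
qed

lemma L2_integrable:
  fixes f :: "'a \<Rightarrow> 'b::euclidean_space"
  assumes "f \<in> L2 \<Omega>" shows "integrable M f"
proof (rule Bochner_Integration.integrable_bound)
  show "integrable M (\<lambda>x. 1 + (norm (f x))\<^sup>2)" using assms by (auto simp: L2_def)
  have "norm y \<le> 1 + (norm y)\<^sup>2" for y :: 'b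
    using zero_le_power2[of "norm y - 1"] zero_le_power2[of "norm y"]
    unfolding power2_diff by (simp; linarith)
  then show "AE x in M. norm (f x) \<le> norm (1 + (norm (f x))\<^sup>2)"
    by (intro AE_I2) (simp add: abs_of_nonneg)
qed (use assms in \<open>auto simp: L2_def\<close>)

lemma L2_lincomb:
  fixes f g :: "'a \<Rightarrow> 'b::euclidean_space"
  assumes f: "f \<in> L2 \<Omega>" and g: "g \<in> L2 \<Omega>"
  shows "(\<lambda>x. a *\<^sub>R f x + b *\<^sub>R g x) \<in> L2 \<Omega>"
proof (rule L2I)
  show "integrable M (\<lambda>x. 2 * (a\<^sup>2 * (norm (f x))\<^sup>2) + 2 * (b\<^sup>2 * (norm (g x))\<^sup>2))"
    using f g by (auto simp: L2_def)
  show "(norm (a *\<^sub>R f x + b *\<^sub>R g x))\<^sup>2 \<le> 2 * (a\<^sup>2 * (norm (f x))\<^sup>2) + 2 * (b\<^sup>2 * (norm (g x))\<^sup>2)" for x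
    using norm_add_squared_le[of "a *\<^sub>R f x" "b *\<^sub>R g x"] by (simp add: power_mult_distrib)
qed (use f g in \<open>auto simp: L2_def\<close>)

lemma continuous_supported:
  assumes "continuous_on UNIV f" "\<And>x. x \<notin> \<Omega> \<Longrightarrow> f x = (0::real)"
  obtains B where "\<And>x. \<bar>f x\<bar> \<le> B"
proof -
  have "{x. f x \<noteq> 0} \<subseteq> \<Omega>" using assms(2) by auto
  then show ?thesis
    using bounded_of_continuous_support[OF assms(1)] bounded_subset[OF bounded_dom] that by blast
qed

lemma integrable_mult_supported:
  assumes g: "integrable M g" and f: "continuous_on UNIV f" "\<And>x. x \<notin> \<Omega> \<Longrightarrow> f x = (0::real)"
  shows "integrable M (\<lambda>x. g x * f x)"
proof -
  obtain B where B: "\<And>x. \<bar>f x\<bar> \<le> B" using continuous_supported[OF f] by blast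
  have [measurable]: "f \<in> borel_measurable M"
    using f(1) by (intro borel_measurable_domain borel_measurable_continuous_onI)
  have [measurable]: "g \<in> borel_measurable M" using g by simp
  have "AE x in M. norm (g x * f x) \<le> norm (B * g x)"
  proof (intro AE_I2)
    fix x
    have "\<bar>f x\<bar> \<le> \<bar>B\<bar>" using B[of x] by linarith
    then show "norm (g x * f x) \<le> norm (B * g x)"
      by (simp add: abs_mult mult.commute[of "\<bar>g x\<bar>"] mult_right_mono)
  qed
  moreover have "integrable M (\<lambda>x. B * g x)" using g by simp
  moreover have "(\<lambda>x. g x * f x) \<in> borel_measurable M" by measurable
  ultimately show ?thesis by (rule Bochner_Integration.integrable_bound[rotated 2])
qed

lemma integrable_supported:
  assumes f: "continuous_on UNIV f" "\<And>x. x \<notin> \<Omega> \<Longrightarrow> f x = (0::real)"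
  shows "integrable M f"
  using integrable_mult_supported[OF _ f, of "\<lambda>_. 1"] by simp

lemma test_function_props:
  assumes "\<psi> \<in> test_functions \<Omega>"
  shows "continuous_on UNIV \<psi>" "\<And>x. x \<notin> \<Omega> \<Longrightarrow> \<psi> x = 0"
  using Ck_imp_continuous[OF test_functionsD(1)[OF assms]] test_functionsD(2)[OF assms] by auto

text \<open>A non-integrable function has Bochner integral 0, so the identities in
  \<open>has_weak_gradient\<close> can be added only once their integrands are known to be
  integrable.\<close>

lemma has_weak_gradient_integrable:
  assumes "has_weak_gradient \<Omega> \<phi> G" "\<psi> \<in> test_functions \<Omega>" "i \<in> Basis"
  shows "integrable M (\<lambda>x. \<phi> x * frechet_derivative \<psi> (at x) i)"
    and "integrable M (\<lambda>x. (G x \<bullet> i) * \<psi> x)"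
proof -
  have "integrable M \<phi>" "integrable M G"
    using assms(1) by (auto simp: has_weak_gradient_def intro: L2_integrable)
  then show "integrable M (\<lambda>x. \<phi> x * frechet_derivative \<psi> (at x) i)"
    "integrable M (\<lambda>x. (G x \<bullet> i) * \<psi> x)"
    using test_function_derivative[OF assms(2)] test_function_props[OF assms(2)] assms(3)
    by (auto intro!: integrable_mult_supported)
qed

lemma has_weak_gradient_lincomb:
  assumes f: "has_weak_gradient \<Omega> \<phi> G" and g: "has_weak_gradient \<Omega> \<eta> H"
  shows "has_weak_gradient \<Omega> (\<lambda>x. a * \<phi> x + b * \<eta> x) (\<lambda>x. a *\<^sub>R G x + b *\<^sub>R H x)"
  unfolding has_weak_gradient_def
proof (intro conjI ballI)
  show "(\<lambda>x. a * \<phi> x + b * \<eta> x) \<in> L2 \<Omega>" "(\<lambda>x. a *\<^sub>R G x + b *\<^sub>R H x) \<in> L2 \<Omega>"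
    using f g L2_lincomb[of \<phi> \<eta> a b] L2_lincomb[of G H a b] by (auto simp: has_weak_gradient_def)
  fix \<psi> :: "'a \<Rightarrow> real" and i :: 'a assume \<psi>: "\<psi> \<in> test_functions \<Omega>" "i \<in> Basis"
  let ?d = "\<lambda>x. frechet_derivative \<psi> (at x) i"
  note int = has_weak_gradient_integrable[OF f \<psi>] has_weak_gradient_integrable[OF g \<psi>]
  have "(LINT x|M. (a * \<phi> x + b * \<eta> x) * ?d x) = a * (LINT x|M. \<phi> x * ?d x) + b * (LINT x|M. \<eta> x * ?d x)"
    using int by (simp add: distrib_right mult.assoc)
  also have "\<dots> = - (a * (LINT x|M. (G x \<bullet> i) * \<psi> x) + b * (LINT x|M. (H x \<bullet> i) * \<psi> x))"
    using f g \<psi> by (simp add: has_weak_gradient_def)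
  also have "\<dots> = - (LINT x|M. ((a *\<^sub>R G x + b *\<^sub>R H x) \<bullet> i) * \<psi> x)"
    using int by (simp add: inner_simps distrib_right mult.assoc)
  finally show "(LINT x|M. (a * \<phi> x + b * \<eta> x) * ?d x) = - (LINT x|M. ((a *\<^sub>R G x + b *\<^sub>R H x) \<bullet> i) * \<psi> x)" .
qed

text \<open>Each component of G - H integrates to 0 against all test functions. Consequently any
  weak gradient found by calculation may replace the chosen \<open>weak_gradient\<close> almost
  everywhere.\<close>

lemma weak_gradient_unique:
  assumes f: "has_weak_gradient \<Omega> \<phi> G" and g: "has_weak_gradient \<Omega> \<phi> H"
  shows "AE x in M. G x = H x"
proof -
  have "AE x in M. (G x - H x) \<bullet> i = 0" if i: "i \<in> Basis" for i
  proof (rule AE_zero_of_test_functions[OF open_dom])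
    have "integrable M G" "integrable M H"
      using f g by (auto simp: has_weak_gradient_def intro: L2_integrable)
    then show "integrable M (\<lambda>x. (G x - H x) \<bullet> i)" by auto
    fix \<psi> assume \<psi>: "\<psi> \<in> test_functions \<Omega>"
    note int = has_weak_gradient_integrable(2)[OF f \<psi> i] has_weak_gradient_integrable(2)[OF g \<psi> i]
    have "(LINT x|M. (G x \<bullet> i) * \<psi> x) = (LINT x|M. (H x \<bullet> i) * \<psi> x)"
      using f g \<psi> i by (fastforce simp: has_weak_gradient_def)
    then show "(LINT x|M. ((G x - H x) \<bullet> i) * \<psi> x) = 0"
      using int by (simp add: inner_simps left_diff_distrib)
  qed
  then have "AE x in M. \<forall>i\<in>Basis. (G x - H x) \<bullet> i = 0"
    by (simp add: AE_ball_countable countable_finite)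
  then show ?thesis
    by eventually_elim (auto simp: inner_simps intro: euclidean_eqI)
qed

section \<open>Dirichlet integral and squared L2 norm\<close>

text \<open>The square of \<open>W12_0_norm\<close>. Working with squares turns the estimates below
  into pointwise inequalities under one integral, in place of Minkowski's and Hoelder's.\<close>

definition dirichlet :: "('a \<Rightarrow> real) \<Rightarrow> real" where
  "dirichlet \<phi> = (LINT x|M. (norm (weak_gradient \<Omega> \<phi> x))\<^sup>2)"

definition sqint :: "('a \<Rightarrow> real) \<Rightarrow> real" where
  "sqint \<phi> = (LINT x|M. (\<phi> x)\<^sup>2)"

lemma dirichlet_nonneg [simp]: "0 \<le> dirichlet \<phi>" and sqint_nonneg [simp]: "0 \<le> sqint \<phi>"
  by (simp_all add: dirichlet_def sqint_def)

lemma W12_weak_gradient: "\<phi> \<in> W12 \<Omega> \<Longrightarrow> has_weak_gradient \<Omega> \<phi> (weak_gradient \<Omega> \<phi>)"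
  using someI_ex[of "has_weak_gradient \<Omega> \<phi>"] by (simp add: W12_def weak_gradient_def)

lemma W12_integrable:
  assumes "\<phi> \<in> W12 \<Omega>"
  shows "\<phi> \<in> borel_measurable M" "weak_gradient \<Omega> \<phi> \<in> borel_measurable M"
    "integrable M \<phi>" "integrable M (\<lambda>x. (\<phi> x)\<^sup>2)"
    "integrable M (\<lambda>x. (norm (weak_gradient \<Omega> \<phi> x))\<^sup>2)"
proof -
  have L: "\<phi> \<in> L2 \<Omega>" "weak_gradient \<Omega> \<phi> \<in> L2 \<Omega>"
    using W12_weak_gradient[OF assms] by (simp_all add: has_weak_gradient_def)
  then show "integrable M \<phi>" by (intro L2_integrable)
  from L show "\<phi> \<in> borel_measurable M" "weak_gradient \<Omega> \<phi> \<in> borel_measurable M"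
    "integrable M (\<lambda>x. (\<phi> x)\<^sup>2)" "integrable M (\<lambda>x. (norm (weak_gradient \<Omega> \<phi> x))\<^sup>2)"
    by (simp_all add: L2_def)
qed

lemma W12_lincomb:
  assumes "\<phi> \<in> W12 \<Omega>" "\<eta> \<in> W12 \<Omega>"
  shows "(\<lambda>x. a * \<phi> x + b * \<eta> x) \<in> W12 \<Omega>"
    and "AE x in M. weak_gradient \<Omega> (\<lambda>x. a * \<phi> x + b * \<eta> x) x =
          a *\<^sub>R weak_gradient \<Omega> \<phi> x + b *\<^sub>R weak_gradient \<Omega> \<eta> x"
proof -
  note h = has_weak_gradient_lincomb[OF assms[THEN W12_weak_gradient], of a b]
  then show "(\<lambda>x. a * \<phi> x + b * \<eta> x) \<in> W12 \<Omega>" by (auto simp: W12_def)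
  then show "AE x in M. weak_gradient \<Omega> (\<lambda>x. a * \<phi> x + b * \<eta> x) x =
          a *\<^sub>R weak_gradient \<Omega> \<phi> x + b *\<^sub>R weak_gradient \<Omega> \<eta> x"
    by (intro weak_gradient_unique[OF W12_weak_gradient h])
qed

lemma W12_add: "\<phi> \<in> W12 \<Omega> \<Longrightarrow> \<eta> \<in> W12 \<Omega> \<Longrightarrow> (\<lambda>x. \<phi> x + \<eta> x) \<in> W12 \<Omega>"
  and W12_diff: "\<phi> \<in> W12 \<Omega> \<Longrightarrow> \<eta> \<in> W12 \<Omega> \<Longrightarrow> (\<lambda>x. \<phi> x - \<eta> x) \<in> W12 \<Omega>"
  using W12_lincomb(1)[of \<phi> \<eta> 1 1] W12_lincomb(1)[of \<phi> \<eta> 1 "-1"] by simp_all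

lemma dirichlet_scale:
  assumes "\<phi> \<in> W12 \<Omega>"
  shows "dirichlet (\<lambda>x. a * \<phi> x) = a\<^sup>2 * dirichlet \<phi>"
proof -
  have W: "(\<lambda>x. a * \<phi> x) \<in> W12 \<Omega>" using W12_lincomb(1)[OF assms assms, of a 0] by simp
  have "dirichlet (\<lambda>x. a * \<phi> x) = (LINT x|M. a\<^sup>2 * (norm (weak_gradient \<Omega> \<phi> x))\<^sup>2)"
    unfolding dirichlet_def
  proof (rule integral_cong_AE)
    show "AE x in M. (norm (weak_gradient \<Omega> (\<lambda>x. a * \<phi> x) x))\<^sup>2 = a\<^sup>2 * (norm (weak_gradient \<Omega> \<phi> x))\<^sup>2"
      using W12_lincomb(2)[OF assms assms, of a 0] by (auto simp: power_mult_distrib)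
  qed (use W12_integrable[OF W] W12_integrable[OF assms] in auto)
  then show ?thesis by (simp add: dirichlet_def)
qed

text \<open>A quadratic inequality between vectors passes to gradients because the weak gradient is
  linear almost everywhere. The factor-2 bound for sums and convexity are instances.\<close>

lemma dirichlet_le:
  assumes f: "\<phi> \<in> W12 \<Omega>" and g: "\<eta> \<in> W12 \<Omega>"
    and le: "\<And>y z :: 'a. (norm (a *\<^sub>R y + b *\<^sub>R z))\<^sup>2 \<le> c * (norm y)\<^sup>2 + d * (norm z)\<^sup>2"
  shows "dirichlet (\<lambda>x. a * \<phi> x + b * \<eta> x) \<le> c * dirichlet \<phi> + d * dirichlet \<eta>"
proof -
  have "dirichlet (\<lambda>x. a * \<phi> x + b * \<eta> x) \<le>
      (LINT x|M. c * (norm (weak_gradient \<Omega> \<phi> x))\<^sup>2 + d * (norm (weak_gradient \<Omega> \<eta> x))\<^sup>2)"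
    unfolding dirichlet_def
  proof (rule integral_mono_AE)
    show "AE x in M. (norm (weak_gradient \<Omega> (\<lambda>x. a * \<phi> x + b * \<eta> x) x))\<^sup>2
       \<le> c * (norm (weak_gradient \<Omega> \<phi> x))\<^sup>2 + d * (norm (weak_gradient \<Omega> \<eta> x))\<^sup>2"
      using W12_lincomb(2)[OF f g, of a b] by eventually_elim (use le in auto)
  qed (use W12_integrable[OF f] W12_integrable[OF g] W12_integrable[OF W12_lincomb(1)[OF f g, of a b]] in auto)
  also have "\<dots> = c * dirichlet \<phi> + d * dirichlet \<eta>"
    using W12_integrable[OF f] W12_integrable[OF g] by (simp add: dirichlet_def)
  finally show ?thesis .
qed

lemma sqint_le:
  assumes f: "\<phi> \<in> W12 \<Omega>" and g: "\<eta> \<in> W12 \<Omega>"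
    and le: "\<And>y z :: real. (a * y + b * z)\<^sup>2 \<le> c * y\<^sup>2 + d * z\<^sup>2"
  shows "sqint (\<lambda>x. a * \<phi> x + b * \<eta> x) \<le> c * sqint \<phi> + d * sqint \<eta>"
proof -
  have "sqint (\<lambda>x. a * \<phi> x + b * \<eta> x) \<le> (LINT x|M. c * (\<phi> x)\<^sup>2 + d * (\<eta> x)\<^sup>2)"
    unfolding sqint_def
    by (rule integral_mono)
      (use le W12_integrable[OF f] W12_integrable[OF g] W12_integrable[OF W12_lincomb(1)[OF f g, of a b]] in auto)
  also have "\<dots> = c * sqint \<phi> + d * sqint \<eta>"
    using W12_integrable[OF f] W12_integrable[OF g] by (simp add: sqint_def)
  finally show ?thesis .
qed

lemma
  assumes f: "\<phi> \<in> W12 \<Omega>" and g: "\<eta> \<in> W12 \<Omega>"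
  shows dirichlet_add_le: "dirichlet (\<lambda>x. \<phi> x + \<eta> x) \<le> 2 * dirichlet \<phi> + 2 * dirichlet \<eta>"
    and sqint_add_le: "sqint (\<lambda>x. \<phi> x + \<eta> x) \<le> 2 * sqint \<phi> + 2 * sqint \<eta>"
  using dirichlet_le[OF f g, of 1 1 2 2] sqint_le[OF f g, of 1 1 2 2] norm_add_squared_le[where 'a='a]
    norm_add_squared_le[where 'a=real] by auto

lemma dirichlet_convex:
  assumes f: "\<phi> \<in> W12 \<Omega>" and g: "\<eta> \<in> W12 \<Omega>" and s: "0 \<le> s" "s \<le> 1"
  shows "dirichlet (\<lambda>x. (1 - s) * \<phi> x + s * \<eta> x) \<le> (1 - s) * dirichlet \<phi> + s * dirichlet \<eta>"
  by (intro dirichlet_le[OF f g] norm_convex_comb_squared_le[OF s])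

lemma dirichlet_diff_le:
  assumes f: "\<phi> \<in> W12 \<Omega>" and g: "\<eta> \<in> W12 \<Omega>" and \<delta>: "\<delta> > 0"
  shows "\<bar>dirichlet \<phi> - dirichlet \<eta>\<bar> \<le> (1 + 1 / \<delta>) * dirichlet (\<lambda>x. \<phi> x - \<eta> x) + \<delta> * dirichlet \<eta>"
proof -
  let ?W = "weak_gradient \<Omega>"
  note fg = W12_integrable[OF f] W12_integrable[OF g] W12_integrable[OF W12_diff[OF f g]]
  have "\<bar>dirichlet \<phi> - dirichlet \<eta>\<bar> = \<bar>LINT x|M. (norm (?W \<phi> x))\<^sup>2 - (norm (?W \<eta> x))\<^sup>2\<bar>"
    using fg by (simp add: dirichlet_def)
  also have "\<dots> \<le> (LINT x|M. \<bar>(norm (?W \<phi> x))\<^sup>2 - (norm (?W \<eta> x))\<^sup>2\<bar>)"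
    by (rule integral_abs_bound)
  also have "\<dots> \<le> (LINT x|M. (1 + 1 / \<delta>) * (norm (?W (\<lambda>x. \<phi> x - \<eta> x) x))\<^sup>2 + \<delta> * (norm (?W \<eta> x))\<^sup>2)"
  proof (rule integral_mono_AE)
    show "AE x in M. \<bar>(norm (?W \<phi> x))\<^sup>2 - (norm (?W \<eta> x))\<^sup>2\<bar> \<le>
       (1 + 1 / \<delta>) * (norm (?W (\<lambda>x. \<phi> x - \<eta> x) x))\<^sup>2 + \<delta> * (norm (?W \<eta> x))\<^sup>2"
      using W12_lincomb(2)[OF f g, of 1 "-1"]
      by eventually_elim (use norm_squared_diff_le[OF \<delta>] in auto)
  qed (use fg in auto)
  also have "\<dots> = (1 + 1 / \<delta>) * dirichlet (\<lambda>x. \<phi> x - \<eta> x) + \<delta> * dirichlet \<eta>"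
    using fg by (simp add: dirichlet_def)
  finally show ?thesis .
qed

end

subsection \<open>The Poincare inequality on the closure of the test functions\<close>

text \<open>This is how q < 2 enters, both in coercivity and in the comparison of
  \<open>qint\<close> at nearby functions.\<close>

lemma powr_le_square:
  fixes \<delta> q :: real
  assumes "\<delta> > 0" "0 \<le> q" "q < 2"
  obtains K where "K > 0" "\<And>t. t \<ge> K \<Longrightarrow> t powr q \<le> \<delta> * t\<^sup>2"
proof
  \<comment> \<open>The solution K of K powr (q - 2) = \<delta>; the left side decreases in K
    because q < 2.\<close>
  let ?K = "\<delta> powr (- 1 / (2 - q))"
  show "?K > 0" using assms by simp
  fix t assume t: "t \<ge> ?K"
  have "?K > 0" using assms by simp
  with t have "t > 0" by linarith
  have "t powr (q - 2) \<le> ?K powr (q - 2)"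
    using t \<open>?K > 0\<close> assms by (intro powr_mono2') auto
  also have "\<dots> = \<delta>"
  proof -
    have "- 1 / (2 - q) * (q - 2) = 1" using assms by (simp add: field_simps)
    then show ?thesis unfolding powr_powr using assms by simp
  qed
  finally have "t powr (q - 2) * t\<^sup>2 \<le> \<delta> * t\<^sup>2" by (intro mult_right_mono) auto
  also have "t powr (q - 2) * t\<^sup>2 = t powr q"
    using \<open>t > 0\<close> by (simp flip: powr_numeral powr_add)
  finally show "t powr q \<le> \<delta> * t\<^sup>2" .
qed

text \<open>Mean value theorem: for q \<ge> 1 the derivative on the interval is largest at its upper
  end. Only interior points are differentiated, which admits b = 0.\<close>

lemma powr_diff_le_Lipschitz:
  fixes a b :: real
  assumes "1 \<le> q" "0 \<le> b" "b \<le> a" "a \<le> K"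
  shows "a powr q - b powr q \<le> q * K powr (q - 1) * (a - b)"
proof (cases "b < a")
  case True
  have cont: "continuous_on {b..a} (\<lambda>t. t powr q)"
    using assms by (intro continuous_on_powr') (auto intro: continuous_intros)
  have "(\<lambda>t. t powr q) differentiable (at x)" if "b < x" "x < a" for x
    using has_real_derivative_powr[of x q] that assms by (auto simp: real_differentiable_def)
  with MVT[OF True cont] obtain l z where z: "b < z" "z < a" "((\<lambda>t. t powr q) has_real_derivative l) (at z)"
    "a powr q - b powr q = (a - b) * l" by (metis)
  have "((\<lambda>t. t powr q) has_real_derivative q * z powr (q - 1)) (at z)"
    using z assms by (intro has_real_derivative_powr) auto
  then have "l = q * z powr (q - 1)" using z(3) by (rule DERIV_unique[rotated])
  moreover have "z powr (q - 1) \<le> K powr (q - 1)"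
    using z assms by (intro powr_mono2) auto
  ultimately have "l \<le> q * K powr (q - 1)" using assms by (simp add: mult_left_mono)
  with True have "(a - b) * l \<le> (a - b) * (q * K powr (q - 1))" by (intro mult_left_mono) auto
  with z(4) show ?thesis by (simp add: mult.commute)
qed (use assms in auto)

text \<open>Where the larger modulus is at most K, the power is Lipschitz; beyond K it is absorbed
  by the quadratic term. After integration an L2 bound makes the first term small and L1 closeness
  the second, in place of interpolation between L1 and L2.\<close>

lemma powr_diff_le:
  fixes q \<delta> :: real
  assumes "\<delta> > 0" "1 \<le> q" "q < 2"
  obtains C where "C > 0"
    "\<And>a b. \<bar>\<bar>a\<bar> powr q - \<bar>b\<bar> powr q\<bar> \<le> \<delta> * (a\<^sup>2 + b\<^sup>2) + C * \<bar>a - b\<bar>"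
proof -
  obtain K where K: "K > 0" "\<And>t. t \<ge> K \<Longrightarrow> t powr q \<le> \<delta> * t\<^sup>2"
    using powr_le_square[of \<delta> q] assms by auto
  define C where "C = q * K powr (q - 1)"
  have C: "C > 0" using K assms by (simp add: C_def)
  have *: "\<bar>a\<bar> powr q - \<bar>b\<bar> powr q \<le> \<delta> * (a\<^sup>2 + b\<^sup>2) + C * \<bar>a - b\<bar>" for a b :: real
  proof -
    have nonneg: "0 \<le> \<delta> * (a\<^sup>2 + b\<^sup>2)" "0 \<le> C * \<bar>a - b\<bar>" using assms C by auto
    consider "\<bar>a\<bar> \<le> \<bar>b\<bar>" | "\<bar>b\<bar> \<le> \<bar>a\<bar>" "\<bar>a\<bar> \<le> K" | "K \<le> \<bar>a\<bar>" by linarith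
    then show ?thesis
    proof cases
      case 1
      then have "\<bar>a\<bar> powr q \<le> \<bar>b\<bar> powr q" using assms by (intro powr_mono2) auto
      with nonneg show ?thesis by linarith
    next
      case 2
      then have "\<bar>a\<bar> powr q - \<bar>b\<bar> powr q \<le> C * (\<bar>a\<bar> - \<bar>b\<bar>)"
        unfolding C_def using assms by (intro powr_diff_le_Lipschitz) auto
      also have "\<dots> \<le> C * \<bar>a - b\<bar>" using C by (intro mult_left_mono) auto
      finally show ?thesis using nonneg by linarith
    next
      case 3
      then have "\<bar>a\<bar> powr q \<le> \<delta> * \<bar>a\<bar>\<^sup>2" by (rule K(2))
      moreover have "0 \<le> \<bar>b\<bar> powr q" "0 \<le> \<delta> * b\<^sup>2" using assms by auto
      ultimately show ?thesis using nonneg unfolding power2_abs distrib_left by linarith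
    qed
  qed
  show ?thesis
  proof (rule that[OF C])
    show "\<bar>\<bar>a\<bar> powr q - \<bar>b\<bar> powr q\<bar> \<le> \<delta> * (a\<^sup>2 + b\<^sup>2) + C * \<bar>a - b\<bar>" for a b
      using *[of a b] *[of b a] by (simp add: abs_le_iff add.commute abs_minus_commute)
  qed
qed

context bounded_open
begin

text \<open>Integration by parts: the partial derivative of a product of two test functions has
  integral 0. It puts test functions into \<open>W12\<close>, so that the estimates for weak
  gradients apply to approximation errors \<phi> - \<psi>.\<close>

lemma test_function_has_weak_gradient:
  assumes \<psi>: "\<psi> \<in> test_functions \<Omega>"
  defines "G \<equiv> \<lambda>x. \<Sum>i\<in>Basis. frechet_derivative \<psi> (at x) i *\<^sub>R i"
  shows "has_weak_gradient \<Omega> \<psi> G"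
proof -
  have Gi: "G x \<bullet> i = frechet_derivative \<psi> (at x) i" if "i \<in> Basis" for x i
    unfolding G_def using that by (simp add: inner_sum_left_Basis)
  have L2: "f \<in> L2 \<Omega>" if f: "continuous_on UNIV f" "\<And>x. x \<notin> \<Omega> \<Longrightarrow> f x = 0" for f :: "'a \<Rightarrow> 'b::euclidean_space"
  proof (rule L2I)
    show "integrable M (\<lambda>x. (norm (f x))\<^sup>2)"
      using f by (intro integrable_supported) (auto intro!: continuous_intros)
    show "f \<in> borel_measurable M"
      using f(1) by (intro borel_measurable_domain borel_measurable_continuous_onI)
  qed simp
  note d = test_function_derivative[OF \<psi>]
  show ?thesis unfolding has_weak_gradient_def
  proof (intro conjI ballI)
    show "\<psi> \<in> L2 \<Omega>" using test_function_props[OF \<psi>] by (intro L2)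
    show "G \<in> L2 \<Omega>"
      unfolding G_def by (intro L2 continuous_on_sum continuous_on_scaleR d continuous_on_const) (simp_all add: d)
    fix \<eta> :: "'a \<Rightarrow> real" and i :: 'a assume \<eta>: "\<eta> \<in> test_functions \<Omega>" and i: "i \<in> Basis"
    note e = test_function_derivative[OF \<eta>]
    let ?d\<psi> = "\<lambda>x. frechet_derivative \<psi> (at x) i" and ?d\<eta> = "\<lambda>x. frechet_derivative \<eta> (at x) i"
    define f' where "f' x h = \<psi> x * frechet_derivative \<eta> (at x) h + frechet_derivative \<psi> (at x) h * \<eta> x" for x h
    have cont: "continuous_on UNIV (\<lambda>x. f' x i)"
      unfolding f'_def using test_function_props[OF \<psi>] test_function_props[OF \<eta>] d(2)[OF i] e(2)[OF i]
      by (intro continuous_intros)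
    have "{x. \<psi> x * \<eta> x \<noteq> 0} \<subseteq> \<Omega>" using test_function_props(2)[OF \<psi>] by auto
    then have bdd: "bounded {x. \<psi> x * \<eta> x \<noteq> 0}" using bounded_subset[OF bounded_dom] by blast
    have "((\<lambda>x. \<psi> x * \<eta> x) has_derivative f' x) (at x)" for x
      unfolding f'_def[abs_def] by (rule has_derivative_mult[OF d(1) e(1)])
    from integral_partial_derivative[where f = "\<lambda>x. \<psi> x * \<eta> x" and f' = f' and i = i, OF this cont i bdd]
    have "(LINT x|lborel. f' x i) = 0" .
    then have "(LINT x|M. f' x i) = 0"
      using cont test_function_props(2)[OF \<psi>] test_function_props(2)[OF \<eta>]
      by (subst integral_lebesgue_on_supported[OF open_dom]) (auto simp: f'_def intro: borel_measurable_continuous_onI)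
    moreover have "integrable M (\<lambda>x. \<psi> x * ?d\<eta> x)" "integrable M (\<lambda>x. ?d\<psi> x * \<eta> x)"
      using test_function_props[OF \<psi>] test_function_props[OF \<eta>] d(2)[OF i] d(3) e(2)[OF i] e(3)
      by (auto intro!: integrable_supported continuous_on_mult)
    ultimately show "(LINT x|M. \<psi> x * ?d\<eta> x) = - (LINT x|M. (G x \<bullet> i) * \<eta> x)"
      using i by (simp add: f'_def Gi)
  qed
qed

lemma test_function_W12: "\<psi> \<in> test_functions \<Omega> \<Longrightarrow> \<psi> \<in> W12 \<Omega>"
  using test_function_has_weak_gradient by (auto simp: W12_def)

text \<open>Integrating \<open>\<partial>\<^sub>i (x\<^sub>i \<psi>\<^sup>2) = \<psi>\<^sup>2 + 2 x\<^sub>i \<psi> \<partial>\<^sub>i \<psi>\<close>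
  gives the inequality without Fubini's theorem.\<close>

lemma Poincare_test_function:
  assumes \<psi>: "\<psi> \<in> test_functions \<Omega>" and R: "\<And>x. x \<in> \<Omega> \<Longrightarrow> norm x \<le> R"
  shows "sqint \<psi> \<le> 4 * R\<^sup>2 * dirichlet \<psi>"
proof -
  obtain i :: 'a where i: "i \<in> Basis" using nonempty_Basis by blast
  define G where "G x = (\<Sum>i\<in>Basis. frechet_derivative \<psi> (at x) i *\<^sub>R i)" for x
  have hG: "has_weak_gradient \<Omega> \<psi> G"
    using test_function_has_weak_gradient[OF \<psi>] by (simp add: G_def[abs_def])
  note d = test_function_derivative[OF \<psi>] and p = test_function_props[OF \<psi>]
  note W = W12_integrable[OF test_function_W12[OF \<psi>]]
  let ?d = "\<lambda>x. frechet_derivative \<psi> (at x) i"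
  have Gi: "G x \<bullet> i = ?d x" for x
    unfolding G_def using i by (simp add: inner_sum_left_Basis)
  have dir: "dirichlet \<psi> = (LINT x|M. (norm (G x))\<^sup>2)"
    unfolding dirichlet_def
  proof (rule integral_cong_AE)
    show "AE x in M. (norm (weak_gradient \<Omega> \<psi> x))\<^sup>2 = (norm (G x))\<^sup>2"
      using weak_gradient_unique[OF W12_weak_gradient[OF test_function_W12[OF \<psi>]] hG] by eventually_elim simp
  qed (use W hG in \<open>auto simp: has_weak_gradient_def L2_def\<close>)
  have intG: "integrable M (\<lambda>x. (norm (G x))\<^sup>2)" using hG by (simp add: has_weak_gradient_def L2_def)
  define f' where "f' x h = (x \<bullet> i) * (\<psi> x * frechet_derivative \<psi> (at x) h + frechet_derivative \<psi> (at x) h * \<psi> x)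
      + (h \<bullet> i) * (\<psi> x * \<psi> x)" for x h
  have cont: "continuous_on UNIV (\<lambda>x. f' x i)"
    unfolding f'_def using p d(2)[OF i] by (intro continuous_intros)
  have zero: "f' x i = 0" if "x \<notin> \<Omega>" for x using p(2)[OF that] by (simp add: f'_def)
  have "{x. (x \<bullet> i) * (\<psi> x * \<psi> x) \<noteq> 0} \<subseteq> \<Omega>" using p(2) by auto
  then have bdd: "bounded {x. (x \<bullet> i) * (\<psi> x * \<psi> x) \<noteq> 0}" using bounded_subset[OF bounded_dom] by blast
  have inn: "((\<lambda>x. x \<bullet> i) has_derivative (\<lambda>h. h \<bullet> i)) (at x)" for x
    by (auto intro!: derivative_eq_intros)
  have "((\<lambda>x. (x \<bullet> i) * (\<psi> x * \<psi> x)) has_derivative f' x) (at x)" for x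
    unfolding f'_def[abs_def] by (rule has_derivative_mult[OF inn has_derivative_mult[OF d(1) d(1)]])
  from integral_partial_derivative[where f = "\<lambda>x. (x \<bullet> i) * (\<psi> x * \<psi> x)" and f' = f' and i = i, OF this cont i bdd]
  have "(LINT x|lborel. f' x i) = 0" .
  then have int0: "(LINT x|M. f' x i) = 0"
    using cont zero
    by (subst integral_lebesgue_on_supported[OF open_dom]) (auto intro: borel_measurable_continuous_onI)
  have intf: "integrable M (\<lambda>x. f' x i)" using cont zero by (rule integrable_supported)
  \<comment> \<open>With u = x_i and v the i-th partial derivative, 2 f' = 2 \<psi>^2 + 4 u v
    \<psi>. Adding 4 R^2 |G|^2, which is at least 4 u^2 v^2, gives at least \<psi>^2 + (\<psi> + 2 u
    v)^2. The integral of f' then drops out.\<close>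
  have "sqint \<psi> \<le> (LINT x|M. 2 * f' x i + 4 * R\<^sup>2 * (norm (G x))\<^sup>2)"
    unfolding sqint_def
  proof (rule integral_mono)
    fix x assume "x \<in> space M"
    then have x: "norm x \<le> R" using R by simp
    define u v where "u = x \<bullet> i" and "v = ?d x"
    have "\<bar>u\<bar> \<le> R" using Basis_le_norm[OF i, of x] x by (simp add: u_def)
    then have "u\<^sup>2 \<le> R\<^sup>2" by (simp add: abs_le_square_iff[symmetric])
    moreover have "\<bar>v\<bar> \<le> norm (G x)" using Basis_le_norm[OF i, of "G x"] by (simp add: Gi v_def)
    then have "v\<^sup>2 \<le> (norm (G x))\<^sup>2" by (simp add: abs_le_square_iff[symmetric])
    ultimately have "u\<^sup>2 * v\<^sup>2 \<le> R\<^sup>2 * (norm (G x))\<^sup>2" by (intro mult_mono) auto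
    moreover have "0 \<le> (\<psi> x + 2 * u * v)\<^sup>2" by simp
    moreover have "f' x i = 2 * u * v * \<psi> x + (\<psi> x)\<^sup>2"
      using i by (simp add: f'_def u_def v_def power2_eq_square algebra_simps)
    ultimately show "(\<psi> x)\<^sup>2 \<le> 2 * f' x i + 4 * R\<^sup>2 * (norm (G x))\<^sup>2"
      by (simp add: power2_sum power_mult_distrib algebra_simps)
  qed (use intf intG W in auto)
  also have "\<dots> = 4 * R\<^sup>2 * dirichlet \<psi>"
    using intf intG int0 by (simp add: dir)
  finally show ?thesis .
qed

lemma W12_norm_less_iff: "\<epsilon> > 0 \<Longrightarrow> W12_norm \<Omega> \<phi> < \<epsilon> \<longleftrightarrow> sqint \<phi> + dirichlet \<phi> < \<epsilon>\<^sup>2"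
proof -
  assume "\<epsilon> > 0"
  have "W12_norm \<Omega> \<phi> = sqrt (sqint \<phi> + dirichlet \<phi>)"
    by (simp add: W12_norm_def L2_norm_def sqint_def dirichlet_def)
  moreover have "\<epsilon> = sqrt (\<epsilon>\<^sup>2)" using \<open>\<epsilon> > 0\<close> by simp
  ultimately show ?thesis by (metis real_sqrt_less_iff)
qed

section \<open>The closure of the test functions as a linear space\<close>

lemma W12_0_iff:
  "\<phi> \<in> W12_0 \<Omega> \<longleftrightarrow> \<phi> \<in> W12 \<Omega> \<and> (\<forall>\<epsilon>>0. \<exists>\<psi>\<in>test_functions \<Omega>.
      sqint (\<lambda>x. \<phi> x - \<psi> x) + dirichlet (\<lambda>x. \<phi> x - \<psi> x) < \<epsilon>)" (is "_ \<longleftrightarrow> _ \<and> ?R")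
proof -
  have "(\<forall>\<epsilon>>0. \<exists>\<psi>\<in>test_functions \<Omega>. W12_norm \<Omega> (\<lambda>x. \<phi> x - \<psi> x) < \<epsilon>) \<longleftrightarrow> ?R"
  proof (intro iffI allI impI)
    fix \<epsilon> :: real assume "\<epsilon> > 0" "\<forall>\<epsilon>>0. \<exists>\<psi>\<in>test_functions \<Omega>. W12_norm \<Omega> (\<lambda>x. \<phi> x - \<psi> x) < \<epsilon>"
    then have "\<exists>\<psi>\<in>test_functions \<Omega>. W12_norm \<Omega> (\<lambda>x. \<phi> x - \<psi> x) < sqrt \<epsilon>" by simp
    with \<open>\<epsilon> > 0\<close> show "\<exists>\<psi>\<in>test_functions \<Omega>. sqint (\<lambda>x. \<phi> x - \<psi> x) + dirichlet (\<lambda>x. \<phi> x - \<psi> x) < \<epsilon>"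
      by (simp add: W12_norm_less_iff)
  qed (simp add: W12_norm_less_iff)
  then show ?thesis by (simp add: W12_0_def)
qed

lemma W12_0_W12: "\<phi> \<in> W12_0 \<Omega> \<Longrightarrow> \<phi> \<in> W12 \<Omega>"
  by (simp add: W12_0_iff)

lemma sqint_scale: "sqint (\<lambda>x. a * \<phi> x) = a\<^sup>2 * sqint \<phi>"
  by (simp add: sqint_def power_mult_distrib)

lemma W12_scale: "\<phi> \<in> W12 \<Omega> \<Longrightarrow> (\<lambda>x. a * \<phi> x) \<in> W12 \<Omega>"
  using W12_lincomb(1)[of \<phi> \<phi> a 0] by simp

lemma W12_0_add:
  assumes f: "\<phi> \<in> W12_0 \<Omega>" and g: "\<eta> \<in> W12_0 \<Omega>"
  shows "(\<lambda>x. \<phi> x + \<eta> x) \<in> W12_0 \<Omega>"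
  unfolding W12_0_iff
proof (intro conjI allI impI)
  show "(\<lambda>x. \<phi> x + \<eta> x) \<in> W12 \<Omega>" using f g by (intro W12_add W12_0_W12)
  fix \<epsilon> :: real assume "\<epsilon> > 0"
  \<comment> \<open>The squared norm of a sum costs a factor 2 for each of the two errors.\<close>
  then have "\<epsilon> / 4 > 0" by simp
  with f g obtain \<psi> \<theta> where \<psi>: "\<psi> \<in> test_functions \<Omega>" "sqint (\<lambda>x. \<phi> x - \<psi> x) + dirichlet (\<lambda>x. \<phi> x - \<psi> x) < \<epsilon> / 4"
    and \<theta>: "\<theta> \<in> test_functions \<Omega>" "sqint (\<lambda>x. \<eta> x - \<theta> x) + dirichlet (\<lambda>x. \<eta> x - \<theta> x) < \<epsilon> / 4"
    unfolding W12_0_iff by meson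
  have W: "(\<lambda>x. \<phi> x - \<psi> x) \<in> W12 \<Omega>" "(\<lambda>x. \<eta> x - \<theta> x) \<in> W12 \<Omega>"
    by (intro W12_diff W12_0_W12[OF f] W12_0_W12[OF g] test_function_W12 \<psi>(1) \<theta>(1))+
  have eq: "(\<lambda>x. \<phi> x + \<eta> x - (\<psi> x + \<theta> x)) = (\<lambda>x. (\<phi> x - \<psi> x) + (\<eta> x - \<theta> x))" by auto
  show "\<exists>\<psi>\<in>test_functions \<Omega>. sqint (\<lambda>x. \<phi> x + \<eta> x - \<psi> x) + dirichlet (\<lambda>x. \<phi> x + \<eta> x - \<psi> x) < \<epsilon>"
    by (rule bexI[OF _ test_functions_add[OF \<psi>(1) \<theta>(1)]], unfold eq)
      (use dirichlet_add_le[OF W] sqint_add_le[OF W] \<psi>(2) \<theta>(2) in linarith)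
qed

lemma W12_0_scale:
  assumes f: "\<phi> \<in> W12_0 \<Omega>"
  shows "(\<lambda>x. a * \<phi> x) \<in> W12_0 \<Omega>"
  unfolding W12_0_iff
proof (intro conjI allI impI)
  show "(\<lambda>x. a * \<phi> x) \<in> W12 \<Omega>" using f by (intro W12_scale W12_0_W12)
  fix \<epsilon> :: real assume "\<epsilon> > 0"
  \<comment> \<open>Dividing by 1 + a^2 instead of a^2 covers a = 0.\<close>
  have a: "1 + a\<^sup>2 > 0" by (simp add: add_pos_nonneg)
  with \<open>\<epsilon> > 0\<close> have "\<epsilon> / (1 + a\<^sup>2) > 0" by simp
  with f obtain \<psi> where \<psi>: "\<psi> \<in> test_functions \<Omega>"
      "sqint (\<lambda>x. \<phi> x - \<psi> x) + dirichlet (\<lambda>x. \<phi> x - \<psi> x) < \<epsilon> / (1 + a\<^sup>2)" (is "?S < _")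
    unfolding W12_0_iff by meson
  have W: "(\<lambda>x. \<phi> x - \<psi> x) \<in> W12 \<Omega>"
    by (intro W12_diff W12_0_W12[OF f] test_function_W12 \<psi>(1))
  have "a\<^sup>2 * ?S \<le> (1 + a\<^sup>2) * ?S" by (intro mult_right_mono) auto
  also have "\<dots> < \<epsilon>" using \<psi>(2) a by (simp add: pos_less_divide_eq mult.commute)
  finally have *: "a\<^sup>2 * ?S < \<epsilon>" .
  have eq: "(\<lambda>x. a * \<phi> x - a * \<psi> x) = (\<lambda>x. a * (\<phi> x - \<psi> x))" by (auto simp: algebra_simps)
  show "\<exists>\<psi>\<in>test_functions \<Omega>. sqint (\<lambda>x. a * \<phi> x - \<psi> x) + dirichlet (\<lambda>x. a * \<phi> x - \<psi> x) < \<epsilon>"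
    by (rule bexI[OF _ test_functions_mult[OF \<psi>(1) Ck_const[of _ a]]], unfold eq)
      (use * in \<open>simp add: sqint_scale dirichlet_scale[OF W] distrib_left\<close>)
qed

lemma W12_0_lincomb:
  "\<phi> \<in> W12_0 \<Omega> \<Longrightarrow> \<eta> \<in> W12_0 \<Omega> \<Longrightarrow> (\<lambda>x. a * \<phi> x + b * \<eta> x) \<in> W12_0 \<Omega>"
  by (intro W12_0_add W12_0_scale)

lemma W12_0_diff:
  "\<phi> \<in> W12_0 \<Omega> \<Longrightarrow> \<eta> \<in> W12_0 \<Omega> \<Longrightarrow> (\<lambda>x. \<phi> x - \<eta> x) \<in> W12_0 \<Omega>"
  using W12_0_lincomb[of \<phi> \<eta> 1 "-1"] by simp

lemma Poincare:
  obtains C where "C > 0" "\<And>\<phi>. \<phi> \<in> W12_0 \<Omega> \<Longrightarrow> sqint \<phi> \<le> C * dirichlet \<phi>"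
proof -
  obtain R where R: "\<And>x. x \<in> \<Omega> \<Longrightarrow> norm x \<le> R" using bounded_dom by (auto simp: bounded_iff)
  \<comment> \<open>The constant 4 R^2 for test functions is doubled twice: once in passing from
    \<phi> to \<psi> in the L2 norm, once in passing back in the Dirichlet integral. The 1 ensures C
    > 0 even if R = 0.\<close>
  define C where "C = 16 * R\<^sup>2 + 1"
  have "sqint \<phi> \<le> C * dirichlet \<phi>" if f: "\<phi> \<in> W12_0 \<Omega>" for \<phi>
  proof (rule field_le_epsilon)
    fix \<epsilon> :: real assume "\<epsilon> > 0"
    define \<delta> where "\<delta> = \<epsilon> / (2 + 16 * R\<^sup>2)"
    have "2 + 16 * R\<^sup>2 > 0" by (simp add: add_pos_nonneg)
    with \<open>\<epsilon> > 0\<close> have \<delta>: "\<delta> > 0" "(2 + 16 * R\<^sup>2) * \<delta> = \<epsilon>" by (simp_all add: \<delta>_def)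
    with f obtain \<psi> where \<psi>: "\<psi> \<in> test_functions \<Omega>"
      "sqint (\<lambda>x. \<phi> x - \<psi> x) + dirichlet (\<lambda>x. \<phi> x - \<psi> x) < \<delta>" unfolding W12_0_iff by meson
    have F: "\<phi> \<in> W12 \<Omega>" and P: "\<psi> \<in> W12 \<Omega>" using f \<psi>(1) by (auto intro: W12_0_W12 test_function_W12)
    have D: "(\<lambda>x. \<phi> x - \<psi> x) \<in> W12 \<Omega>" "(\<lambda>x. (-1) * (\<phi> x - \<psi> x)) \<in> W12 \<Omega>"
      using W12_diff[OF F P] W12_scale by blast+
    have s: "sqint \<phi> \<le> 2 * sqint (\<lambda>x. \<phi> x - \<psi> x) + 2 * sqint \<psi>"
      using sqint_add_le[OF D(1) P] by simp
    have "dirichlet \<psi> \<le> 2 * dirichlet \<phi> + 2 * dirichlet (\<lambda>x. (-1) * (\<phi> x - \<psi> x))"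
      using dirichlet_add_le[OF F D(2)] by simp
    also have "dirichlet (\<lambda>x. (-1) * (\<phi> x - \<psi> x)) = dirichlet (\<lambda>x. \<phi> x - \<psi> x)"
      using dirichlet_scale[OF D(1), of "-1"] by simp
    finally have "R\<^sup>2 * dirichlet \<psi> \<le> R\<^sup>2 * (2 * dirichlet \<phi> + 2 * dirichlet (\<lambda>x. \<phi> x - \<psi> x))"
      by (intro mult_left_mono) auto
    moreover have "dirichlet (\<lambda>x. \<phi> x - \<psi> x) \<le> \<delta>" "sqint (\<lambda>x. \<phi> x - \<psi> x) \<le> \<delta>"
      using \<psi>(2) dirichlet_nonneg[of "\<lambda>x. \<phi> x - \<psi> x"] sqint_nonneg[of "\<lambda>x. \<phi> x - \<psi> x"] by linarith+
    moreover from this(1) have "R\<^sup>2 * dirichlet (\<lambda>x. \<phi> x - \<psi> x) \<le> R\<^sup>2 * \<delta>" by (intro mult_left_mono) auto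
    moreover note s Poincare_test_function[OF \<psi>(1) R]
    ultimately have "sqint \<phi> \<le> 16 * R\<^sup>2 * dirichlet \<phi> + (2 + 16 * R\<^sup>2) * \<delta>"
      by (simp add: algebra_simps)
    then show "sqint \<phi> \<le> C * dirichlet \<phi> + \<epsilon>"
      unfolding \<delta>(2) C_def using dirichlet_nonneg[of \<phi>] unfolding distrib_right by linarith
  qed
  moreover have "C > 0" by (simp add: C_def add_nonneg_pos)
  ultimately show ?thesis using that by blast
qed

end

subsection \<open>The energy along segments\<close>

text \<open>Handles the degenerate case of the estimates below, in which the natural choice of
  \<delta>, a norm, would be 0.\<close>

lemma le_of_forall_le_eps_mult:
  fixes x a :: real
  assumes "\<And>\<delta>. \<delta> > 0 \<Longrightarrow> x \<le> \<delta> * a" "0 \<le> a"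
  shows "x \<le> 0"
proof (rule field_le_epsilon)
  fix \<epsilon> :: real assume "\<epsilon> > 0"
  then have "x \<le> \<epsilon> / (a + 1) * a" using assms(2) by (intro assms(1)) simp
  also have "\<dots> \<le> \<epsilon>" using assms(2) \<open>\<epsilon> > 0\<close> by (simp add: field_simps)
  finally show "x \<le> 0 + \<epsilon>" by simp
qed

context bounded_open
begin

lemma W12_0_norm_eq: "W12_0_norm \<Omega> \<phi> = sqrt (dirichlet \<phi>)"
  by (simp add: W12_0_norm_def L2_norm_def dirichlet_def)

lemma W12_0_norm_nonneg [simp]: "0 \<le> W12_0_norm \<Omega> \<phi>"
  by (simp add: W12_0_norm_eq)

lemma dirichlet_eq: "dirichlet \<phi> = (W12_0_norm \<Omega> \<phi>)\<^sup>2"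
  by (simp add: W12_0_norm_eq)

lemma W12_0_norm_scale: "\<phi> \<in> W12_0 \<Omega> \<Longrightarrow> W12_0_norm \<Omega> (\<lambda>x. a * \<phi> x) = \<bar>a\<bar> * W12_0_norm \<Omega> \<phi>"
  by (simp add: W12_0_norm_eq dirichlet_scale[OF W12_0_W12] real_sqrt_mult)

text \<open>Taking \<delta> = n in \<open>dirichlet_diff_le\<close> turns (1 + 1/n) n^2 into n^2 +
  n; if n = 0, \<delta> tends to 0 instead. The resulting bound vanishes with n.\<close>

lemma dirichlet_diff_le_norm:
  assumes "\<phi> \<in> W12_0 \<Omega>" "\<eta> \<in> W12_0 \<Omega>"
  defines "n \<equiv> W12_0_norm \<Omega> (\<lambda>x. \<phi> x - \<eta> x)"
  shows "\<bar>dirichlet \<phi> - dirichlet \<eta>\<bar> \<le> n\<^sup>2 + n + n * dirichlet \<eta>"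
proof (cases "n = 0")
  case True
  have "\<bar>dirichlet \<phi> - dirichlet \<eta>\<bar> \<le> 0"
  proof (rule le_of_forall_le_eps_mult)
    show "\<bar>dirichlet \<phi> - dirichlet \<eta>\<bar> \<le> \<delta> * dirichlet \<eta>" if "\<delta> > 0" for \<delta>
      using dirichlet_diff_le[OF assms(1,2)[THEN W12_0_W12] that] True
      by (simp add: dirichlet_eq[of "\<lambda>x. \<phi> x - \<eta> x"] n_def)
  qed simp
  with True show ?thesis by simp
next
  case False
  then have "n > 0" using W12_0_norm_nonneg[of "\<lambda>x. \<phi> x - \<eta> x"] unfolding n_def by linarith
  have "\<bar>dirichlet \<phi> - dirichlet \<eta>\<bar> \<le> (1 + 1 / n) * n\<^sup>2 + n * dirichlet \<eta>"
    using dirichlet_diff_le[OF assms(1,2)[THEN W12_0_W12] \<open>n > 0\<close>]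
    by (simp only: dirichlet_eq[of "\<lambda>x. \<phi> x - \<eta> x"] n_def)
  also have "(1 + 1 / n) * n\<^sup>2 = n\<^sup>2 + n"
    using \<open>n > 0\<close> by (simp add: field_simps power2_eq_square)
  finally show ?thesis .
qed

text \<open>Integrating |t| \<le> \<delta> + t^2/\<delta> and applying the Poincare inequality
  bounds the L1 norm by \<delta> A + C n^2/\<delta>, with n the gradient norm; the choice \<delta> =
  n balances the two terms and yields the constant A + C.\<close>

lemma L1_norm_le_W12_0_norm:
  obtains K where "K > 0" "\<And>\<phi>. \<phi> \<in> W12_0 \<Omega> \<Longrightarrow> L1_norm \<Omega> \<phi> \<le> K * W12_0_norm \<Omega> \<phi>"
proof -
  obtain C where C: "C > 0" "\<And>\<phi>. \<phi> \<in> W12_0 \<Omega> \<Longrightarrow> sqint \<phi> \<le> C * dirichlet \<phi>"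
    using Poincare by blast
  define A where "A = measure M (space M)"
  have A: "A \<ge> 0" by (simp add: A_def)
  have le: "L1_norm \<Omega> \<phi> \<le> \<delta> * A + C * dirichlet \<phi> / \<delta>" if f: "\<phi> \<in> W12_0 \<Omega>" and \<delta>: "\<delta> > 0" for \<phi> \<delta>
  proof -
    note W = W12_integrable[OF W12_0_W12[OF f]]
    have "L1_norm \<Omega> \<phi> \<le> (LINT x|M. \<delta> + (\<phi> x)\<^sup>2 / \<delta>)"
      unfolding L1_norm_def
    proof (rule integral_mono)
      fix x
      have "0 \<le> ((\<bar>\<phi> x\<bar> - \<delta>)\<^sup>2 + \<delta> * \<bar>\<phi> x\<bar>) / \<delta>" using \<delta> by simp
      then show "\<bar>\<phi> x\<bar> \<le> \<delta> + (\<phi> x)\<^sup>2 / \<delta>"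
        using \<delta> by (simp add: power2_diff field_simps power2_eq_square)
    qed (use W in auto)
    also have "\<dots> = \<delta> * A + sqint \<phi> / \<delta>" using W by (simp add: A_def sqint_def)
    also have "\<dots> \<le> \<delta> * A + C * dirichlet \<phi> / \<delta>"
      using C(2)[OF f] \<delta> by (simp add: divide_right_mono)
    finally show ?thesis .
  qed
  show ?thesis
  proof (rule that)
    show "A + C > 0" using A C by simp
    fix \<phi> assume f: "\<phi> \<in> W12_0 \<Omega>"
    define n where "n = W12_0_norm \<Omega> \<phi>"
    have n: "dirichlet \<phi> = n\<^sup>2" "n \<ge> 0" by (simp_all add: n_def dirichlet_eq)
    have "L1_norm \<Omega> \<phi> \<le> (A + C) * n"
    proof (cases "n = 0")
      case True
      have "L1_norm \<Omega> \<phi> \<le> 0"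
        by (rule le_of_forall_le_eps_mult[OF _ A]) (use le[OF f] n True in auto)
      with True show ?thesis by simp
    next
      case False
      with n have "n > 0" by simp
      with le[OF f this] n show ?thesis by (simp add: power2_eq_square algebra_simps)
    qed
    then show "L1_norm \<Omega> \<phi> \<le> (A + C) * W12_0_norm \<Omega> \<phi>" by (simp add: n_def)
  qed
qed

lemma L1_norm_scale: "L1_norm \<Omega> (\<lambda>x. a * \<phi> x) = \<bar>a\<bar> * L1_norm \<Omega> \<phi>"
  by (simp add: L1_norm_def abs_mult)

lemma L1_norm_nonneg [simp]: "0 \<le> L1_norm \<Omega> \<phi>"
  by (simp add: L1_norm_def)

end

section \<open>Coercivity of the energy and its behaviour on segments\<close>

locale sublinear_energy = bounded_open \<Omega> for \<Omega> :: "'a::euclidean_space set" +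
  fixes q \<alpha> :: real
  assumes q: "1 < q" "q < 2" and \<alpha>: "\<alpha> > 0"
begin

abbreviation "F \<equiv> energy q \<alpha> \<Omega>"

definition qint :: "('a \<Rightarrow> real) \<Rightarrow> real" where
  "qint \<phi> = (LINT x|M. \<bar>\<phi> x\<bar> powr q)"

lemma energy_eq: "F \<phi> = 1/2 * dirichlet \<phi> - \<alpha> / q * qint \<phi>"
  by (simp add: energy_def dirichlet_def qint_def)

lemma powr_integrable:
  assumes "\<phi> \<in> W12 \<Omega>"
  shows "integrable M (\<lambda>x. \<bar>\<phi> x\<bar> powr q)"
proof (rule Bochner_Integration.integrable_bound)
  note W = W12_integrable[OF assms]
  show "integrable M (\<lambda>x. 1 + (\<phi> x)\<^sup>2)" using W by simp
  show "(\<lambda>x. \<bar>\<phi> x\<bar> powr q) \<in> borel_measurable M" using W(1) by measurable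
  have "\<bar>t\<bar> powr q \<le> 1 + t\<^sup>2" for t :: real
  proof (cases "\<bar>t\<bar> \<le> 1")
    case True
    then have "\<bar>t\<bar> powr q \<le> 1" using q by (intro powr_le1) auto
    then show ?thesis using zero_le_power2[of t] by linarith
  next
    case False
    then have "\<bar>t\<bar> powr q \<le> \<bar>t\<bar> powr 2" using q by (intro powr_mono) auto
    also have "\<dots> = t\<^sup>2" using False by (subst powr_numeral) auto
    finally show ?thesis by simp
  qed
  then show "AE x in M. norm (\<bar>\<phi> x\<bar> powr q) \<le> norm (1 + (\<phi> x)\<^sup>2)"
    by (intro AE_I2) (simp add: abs_of_nonneg)
qed

lemma qint_diff_le:
  assumes "\<delta> > 0"
  obtains C where "C > 0" "\<And>\<phi> \<eta>. \<phi> \<in> W12 \<Omega> \<Longrightarrow> \<eta> \<in> W12 \<Omega> \<Longrightarrow>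
    \<bar>qint \<phi> - qint \<eta>\<bar> \<le> \<delta> * (sqint \<phi> + sqint \<eta>) + C * L1_norm \<Omega> (\<lambda>x. \<phi> x - \<eta> x)"
proof -
  obtain C where C: "C > 0"
    "\<And>a b. \<bar>\<bar>a\<bar> powr q - \<bar>b\<bar> powr q\<bar> \<le> \<delta> * (a\<^sup>2 + b\<^sup>2) + C * \<bar>a - b\<bar>"
    using powr_diff_le[OF assms, of q] q by auto
  show ?thesis
  proof (rule that[OF C(1)])
    fix \<phi> \<eta> assume f: "\<phi> \<in> W12 \<Omega>" and g: "\<eta> \<in> W12 \<Omega>"
    note W = W12_integrable[OF f] W12_integrable[OF g] powr_integrable[OF f] powr_integrable[OF g]
    have "\<bar>qint \<phi> - qint \<eta>\<bar> = \<bar>LINT x|M. \<bar>\<phi> x\<bar> powr q - \<bar>\<eta> x\<bar> powr q\<bar>"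
      using W by (simp add: qint_def)
    also have "\<dots> \<le> (LINT x|M. \<bar>\<bar>\<phi> x\<bar> powr q - \<bar>\<eta> x\<bar> powr q\<bar>)"
      by (rule integral_abs_bound)
    also have "\<dots> \<le> (LINT x|M. \<delta> * ((\<phi> x)\<^sup>2 + (\<eta> x)\<^sup>2) + C * \<bar>\<phi> x - \<eta> x\<bar>)"
      by (rule integral_mono) (use W C(2) in auto)
    also have "\<dots> = \<delta> * (sqint \<phi> + sqint \<eta>) + C * L1_norm \<Omega> (\<lambda>x. \<phi> x - \<eta> x)"
      using W by (simp add: sqint_def L1_norm_def)
    finally show "\<bar>qint \<phi> - qint \<eta>\<bar> \<le> \<delta> * (sqint \<phi> + sqint \<eta>) + C * L1_norm \<Omega> (\<lambda>x. \<phi> x - \<eta> x)" .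
  qed
qed

text \<open>Coercivity: values of modulus above K contribute a small multiple of the squared L2
  norm, hence of the Dirichlet integral; the others contribute at most a constant, the measure being
  finite.\<close>

lemma dirichlet_bounded_of_energy_le:
  obtains B where "B \<ge> 0" "\<And>\<phi>. \<phi> \<in> W12_0 \<Omega> \<Longrightarrow> F \<phi> \<le> m \<Longrightarrow> dirichlet \<phi> \<le> B"
proof -
  obtain C where C: "C > 0" "\<And>\<phi>. \<phi> \<in> W12_0 \<Omega> \<Longrightarrow> sqint \<phi> \<le> C * dirichlet \<phi>"
    using Poincare by blast
  \<comment> \<open>Chosen so that the power term absorbs only 1/4 of the Dirichlet integral,
    leaving 1/4 out of the coefficient 1/2.\<close>
  define \<delta> where "\<delta> = q / (4 * \<alpha> * C)"
  have \<delta>: "\<delta> > 0" "\<alpha> / q * (\<delta> * C) = 1/4" using q \<alpha> C by (simp_all add: \<delta>_def)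
  obtain K where K: "K > 0" "\<And>t. t \<ge> K \<Longrightarrow> t powr q \<le> \<delta> * t\<^sup>2"
    using powr_le_square[of \<delta> q] \<delta> q by auto
  define A where "A = K powr q * measure M (space M)"
  define B where "B = max 0 (4 * (m + \<alpha> / q * A))"
  have "dirichlet \<phi> \<le> B" if f: "\<phi> \<in> W12_0 \<Omega>" and m: "F \<phi> \<le> m" for \<phi>
  proof -
    note W = W12_integrable[OF W12_0_W12[OF f]] powr_integrable[OF W12_0_W12[OF f]]
    have "qint \<phi> \<le> (LINT x|M. K powr q + \<delta> * (\<phi> x)\<^sup>2)"
      unfolding qint_def
    proof (rule integral_mono)
      fix x
      show "\<bar>\<phi> x\<bar> powr q \<le> K powr q + \<delta> * (\<phi> x)\<^sup>2"
      proof (cases "\<bar>\<phi> x\<bar> \<le> K")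
        case True
        then have "\<bar>\<phi> x\<bar> powr q \<le> K powr q" using q by (intro powr_mono2) auto
        moreover have "0 \<le> \<delta> * (\<phi> x)\<^sup>2" using \<delta> by simp
        ultimately show ?thesis by linarith
      next
        case False
        then have "\<bar>\<phi> x\<bar> powr q \<le> \<delta> * \<bar>\<phi> x\<bar>\<^sup>2" by (intro K) auto
        moreover have "0 \<le> K powr q" by simp
        ultimately show ?thesis unfolding power2_abs by linarith
      qed
    qed (use W in auto)
    also have "\<dots> = A + \<delta> * sqint \<phi>" using W by (simp add: A_def sqint_def)
    also have "\<dots> \<le> A + \<delta> * (C * dirichlet \<phi>)" using C(2)[OF f] \<delta> by simp
    finally have "\<alpha> / q * qint \<phi> \<le> \<alpha> / q * (A + \<delta> * (C * dirichlet \<phi>))"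
      using q \<alpha> by (intro mult_left_mono) auto
    also have "\<dots> = \<alpha> / q * A + (\<alpha> / q * (\<delta> * C)) * dirichlet \<phi>" by (simp only: distrib_left mult.assoc)
    finally have "\<alpha> / q * qint \<phi> \<le> \<alpha> / q * A + 1/4 * dirichlet \<phi>" unfolding \<delta>(2) .
    moreover have "d \<le> 4 * (m + y)" if "x \<le> y + 1/4 * d" "1/2 * d - x \<le> m" for d x y :: real
      using that by simp
    ultimately have "dirichlet \<phi> \<le> 4 * (m + \<alpha> / q * A)" using m unfolding energy_eq by blast
    then show ?thesis by (simp add: B_def)
  qed
  moreover have "B \<ge> 0" by (simp add: B_def)
  ultimately show ?thesis using that by blast
qed

text \<open>The Dirichlet part is convex along the segment, so only \<open>qint\<close> can cause an
  excess. It is compared at the intermediate point z with both ends, and the two comparisons are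
  averaged with weights 1 - s and s.\<close>

lemma energy_segment_le:
  assumes "\<epsilon> > 0" "B \<ge> 0"
  obtains \<rho> where "\<rho> > 0" "\<And>\<phi> \<eta> s. \<phi> \<in> W12_0 \<Omega> \<Longrightarrow> \<eta> \<in> W12_0 \<Omega> \<Longrightarrow> dirichlet \<phi> \<le> B \<Longrightarrow> dirichlet \<eta> \<le> B \<Longrightarrow>
     L1_norm \<Omega> (\<lambda>x. \<phi> x - \<eta> x) < \<rho> \<Longrightarrow> 0 \<le> s \<Longrightarrow> s \<le> 1 \<Longrightarrow>
     F (\<lambda>x. (1 - s) * \<phi> x + s * \<eta> x) \<le> (1 - s) * F \<phi> + s * F \<eta> + \<epsilon>"
proof -
  obtain C where C: "C > 0" "\<And>\<phi>. \<phi> \<in> W12_0 \<Omega> \<Longrightarrow> sqint \<phi> \<le> C * dirichlet \<phi>"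
    using Poincare by blast
  \<comment> \<open>Bounds \<open>sqint\<close> at both ends and, by convexity of the Dirichlet
    integral, at z. The 1 makes it positive, as it becomes a divisor.\<close>
  define S where "S = C * B + 1"
  have S: "S > 0" using C assms by (simp add: S_def add_nonneg_pos)
  \<comment> \<open>After multiplication by \<alpha>/q, the quadratic error governed by \<delta> and
    the L1 error governed by \<rho> cost \<epsilon>/2 each. The order matters: K depends on
    \<delta>, and \<rho> on K.\<close>
  define \<delta> where "\<delta> = \<epsilon> * q / (4 * \<alpha> * S)"
  have \<delta>: "\<delta> > 0" "\<alpha> / q * (\<delta> * (S + S)) = \<epsilon> / 2" using q \<alpha> S assms by (simp_all add: \<delta>_def)
  obtain K where K: "K > 0" "\<And>\<phi> \<eta>. \<phi> \<in> W12 \<Omega> \<Longrightarrow> \<eta> \<in> W12 \<Omega> \<Longrightarrow>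
    \<bar>qint \<phi> - qint \<eta>\<bar> \<le> \<delta> * (sqint \<phi> + sqint \<eta>) + K * L1_norm \<Omega> (\<lambda>x. \<phi> x - \<eta> x)"
    using qint_diff_le[OF \<delta>(1)] by blast
  define \<rho> where "\<rho> = \<epsilon> * q / (2 * \<alpha> * K)"
  have \<rho>: "\<rho> > 0" "\<alpha> / q * (K * \<rho>) = \<epsilon> / 2" using q \<alpha> K assms by (simp_all add: \<rho>_def)
  show ?thesis
  proof (rule that[OF \<rho>(1)])
    fix \<phi> \<eta> s assume f: "\<phi> \<in> W12_0 \<Omega>" and g: "\<eta> \<in> W12_0 \<Omega>" and dir: "dirichlet \<phi> \<le> B" "dirichlet \<eta> \<le> B"
      and L: "L1_norm \<Omega> (\<lambda>x. \<phi> x - \<eta> x) < \<rho>" and s: "0 \<le> s" "s \<le> (1::real)"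
    define z where "z x = (1 - s) * \<phi> x + s * \<eta> x" for x
    have z: "z \<in> W12_0 \<Omega>" unfolding z_def[abs_def] using f g by (rule W12_0_lincomb)
    have dz: "dirichlet z \<le> (1 - s) * dirichlet \<phi> + s * dirichlet \<eta>"
      unfolding z_def[abs_def] using f g s by (intro dirichlet_convex W12_0_W12)
    also have "\<dots> \<le> (1 - s) * B + s * B" using dir s by (intro add_mono mult_left_mono) auto
    finally have "dirichlet z \<le> B" by (simp add: algebra_simps)
    have sq: "sqint u \<le> S" if "u \<in> W12_0 \<Omega>" "dirichlet u \<le> B" for u
    proof -
      have "C * dirichlet u \<le> C * B" using C that by simp
      with C(2)[OF that(1)] show ?thesis by (simp add: S_def)
    qed
    have q1: "qint u - qint z \<le> \<delta> * (S + S) + K * \<rho>"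
      if u: "u \<in> W12_0 \<Omega>" "dirichlet u \<le> B" and l: "L1_norm \<Omega> (\<lambda>x. u x - z x) \<le> \<rho>" for u
    proof -
      have "qint u - qint z \<le> \<delta> * (sqint u + sqint z) + K * L1_norm \<Omega> (\<lambda>x. u x - z x)"
        using K(2)[OF u(1)[THEN W12_0_W12] z[THEN W12_0_W12]] by linarith
      also have "\<dots> \<le> \<delta> * (S + S) + K * \<rho>"
        using sq[OF u] sq[OF z \<open>dirichlet z \<le> B\<close>] l \<delta> K(1) by (intro add_mono mult_left_mono) auto
      finally show ?thesis .
    qed
    have "(\<lambda>x. \<phi> x - z x) = (\<lambda>x. s * (\<phi> x - \<eta> x))" "(\<lambda>x. \<eta> x - z x) = (\<lambda>x. (s - 1) * (\<phi> x - \<eta> x))"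
      by (auto simp: z_def algebra_simps)
    then have "L1_norm \<Omega> (\<lambda>x. \<phi> x - z x) = s * L1_norm \<Omega> (\<lambda>x. \<phi> x - \<eta> x)"
      "L1_norm \<Omega> (\<lambda>x. \<eta> x - z x) = (1 - s) * L1_norm \<Omega> (\<lambda>x. \<phi> x - \<eta> x)"
      using s by (simp_all add: L1_norm_scale)
    moreover have "s * L1_norm \<Omega> (\<lambda>x. \<phi> x - \<eta> x) \<le> 1 * L1_norm \<Omega> (\<lambda>x. \<phi> x - \<eta> x)"
      "(1 - s) * L1_norm \<Omega> (\<lambda>x. \<phi> x - \<eta> x) \<le> 1 * L1_norm \<Omega> (\<lambda>x. \<phi> x - \<eta> x)"
      using s by (intro mult_right_mono; simp)+
    ultimately have "L1_norm \<Omega> (\<lambda>x. \<phi> x - z x) \<le> \<rho>" "L1_norm \<Omega> (\<lambda>x. \<eta> x - z x) \<le> \<rho>" using L by simp_all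
    from q1[OF f dir(1) this(1)] q1[OF g dir(2) this(2)]
    have "(1 - s) * (qint \<phi> - qint z) + s * (qint \<eta> - qint z)
        \<le> (1 - s) * (\<delta> * (S + S) + K * \<rho>) + s * (\<delta> * (S + S) + K * \<rho>)"
      using s by (intro add_mono mult_left_mono) auto
    then have "(1 - s) * qint \<phi> + s * qint \<eta> - qint z \<le> \<delta> * (S + S) + K * \<rho>"
      by (simp add: algebra_simps)
    then have "\<alpha> / q * ((1 - s) * qint \<phi> + s * qint \<eta> - qint z) \<le> \<alpha> / q * (\<delta> * (S + S) + K * \<rho>)"
      using q \<alpha> by (intro mult_left_mono) auto
    also have "\<dots> = \<epsilon>" unfolding distrib_left[of "\<alpha> / q"] \<delta>(2) \<rho>(2) by simp
    finally have "\<alpha> / q * ((1 - s) * qint \<phi> + s * qint \<eta> - qint z) \<le> \<epsilon>" .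
    then have "(1 - s) * (\<alpha> / q * qint \<phi>) + s * (\<alpha> / q * qint \<eta>) - \<alpha> / q * qint z \<le> \<epsilon>"
      by (simp only: right_diff_distrib distrib_left mult.left_commute)
    with dz have "F z \<le> (1 - s) * F \<phi> + s * F \<eta> + \<epsilon>"
      unfolding energy_eq right_diff_distrib[of "1 - s"] right_diff_distrib[of s] by linarith
    then show "F (\<lambda>x. (1 - s) * \<phi> x + s * \<eta> x) \<le> (1 - s) * F \<phi> + s * F \<eta> + \<epsilon>"
      by (simp add: z_def[abs_def])
  qed
qed

lemma energy_neg:
  assumes "\<phi> \<in> W12_0 \<Omega>"
  shows "F (\<lambda>x. - \<phi> x) = F \<phi>"
  using dirichlet_scale[OF W12_0_W12[OF assms], of "-1"] by (simp add: energy_eq qint_def)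

end

subsection \<open>Paths\<close>

context bounded_open
begin

text \<open>The type \<open>'a \<Rightarrow> real\<close> does not carry the topology of
  \<open>W12_0_norm\<close>, so \<open>continuous_on\<close> cannot express this. The set S is
  variable to allow halves of an interval in concatenations and the half-line.\<close>

definition path_continuous_on :: "real set \<Rightarrow> (real \<Rightarrow> 'a \<Rightarrow> real) \<Rightarrow> bool" where
  "path_continuous_on S \<gamma> \<longleftrightarrow> (\<forall>t\<in>S. \<gamma> t \<in> W12_0 \<Omega>) \<and>
     (\<forall>t\<in>S. ((\<lambda>s. W12_0_norm \<Omega> (\<lambda>x. \<gamma> s x - \<gamma> t x)) \<longlongrightarrow> 0) (at t within S))"

lemma path_continuous_onD:
  assumes "path_continuous_on S \<gamma>" "t \<in> S"
  shows "\<gamma> t \<in> W12_0 \<Omega>"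
    and "((\<lambda>s. W12_0_norm \<Omega> (\<lambda>x. \<gamma> s x - \<gamma> t x)) \<longlongrightarrow> 0) (at t within S)"
  using assms by (auto simp: path_continuous_on_def)

lemma path_continuous_on_cong:
  assumes "path_continuous_on S \<gamma>" "\<And>t. t \<in> S \<Longrightarrow> \<gamma> t = \<gamma>' t"
  shows "path_continuous_on S \<gamma>'"
  unfolding path_continuous_on_def
proof (intro conjI ballI)
  fix t assume t: "t \<in> S"
  then show "\<gamma>' t \<in> W12_0 \<Omega>" using assms by (auto simp: path_continuous_on_def)
  show "((\<lambda>s. W12_0_norm \<Omega> (\<lambda>x. \<gamma>' s x - \<gamma>' t x)) \<longlongrightarrow> 0) (at t within S)"
    by (rule Lim_transform_eventually[OF path_continuous_onD(2)[OF assms(1) t]])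
      (use assms(2) t in \<open>auto simp: eventually_at_filter\<close>)
qed

text \<open>The \<open>weak_gradient\<close> chosen for the zero function is known to vanish only
  almost everywhere; scaling by 0 settles its norm.\<close>

lemma W12_0_norm_self: "\<phi> \<in> W12_0 \<Omega> \<Longrightarrow> W12_0_norm \<Omega> (\<lambda>x. \<phi> x - \<phi> x) = 0"
  using W12_0_norm_scale[of \<phi> 0] by simp

lemma path_continuous_on_compose:
  assumes \<gamma>: "path_continuous_on S \<gamma>" and h: "continuous_on T h" "h ` T \<subseteq> S"
  shows "path_continuous_on T (\<lambda>t. \<gamma> (h t))"
  unfolding path_continuous_on_def
proof (intro conjI ballI)
  fix t assume t: "t \<in> T"
  then have ht: "h t \<in> S" using h by auto
  then show W: "\<gamma> (h t) \<in> W12_0 \<Omega>" using \<gamma> by (rule path_continuous_onD[rotated])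
  let ?N = "\<lambda>s. W12_0_norm \<Omega> (\<lambda>x. \<gamma> s x - \<gamma> (h t) x)"
  \<comment> \<open>The map h may take the value h t repeatedly, so the punctured limit cannot be
    composed directly. Since N is 0 at h t, the limit is continuity of a real function, which
    can.\<close>
  have "continuous (at (h t) within S) ?N"
    unfolding continuous_within using path_continuous_onD(2)[OF \<gamma> ht] W12_0_norm_self[OF W] by simp
  then have "continuous (at (h t) within h ` T) ?N" using h(2) by (rule continuous_within_subset)
  moreover have "continuous (at t within T) h" using h(1) t by (simp add: continuous_on_eq_continuous_within)
  ultimately have "continuous (at t within T) (\<lambda>s. ?N (h s))" by (rule continuous_within_compose2[rotated])
  then show "((\<lambda>s. ?N (h s)) \<longlongrightarrow> 0) (at t within T)"
    unfolding continuous_within using W12_0_norm_self[OF W] by simp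
qed

text \<open>At a point outside one of the closed sets the limit within that set is vacuous, so the
  two one-set limits can always be combined.\<close>

lemma path_continuous_on_Un:
  assumes S: "path_continuous_on S \<gamma>" "closed S" and T: "path_continuous_on T \<gamma>" "closed T"
  shows "path_continuous_on (S \<union> T) \<gamma>"
  unfolding path_continuous_on_def
proof (intro conjI ballI)
  fix t assume t: "t \<in> S \<union> T"
  then show "\<gamma> t \<in> W12_0 \<Omega>" using S T path_continuous_onD(1) by blast
  have "((\<lambda>s. W12_0_norm \<Omega> (\<lambda>x. \<gamma> s x - \<gamma> t x)) \<longlongrightarrow> 0) (at t within U)"
    if U: "path_continuous_on U \<gamma>" "closed U" for U
  proof (cases "t \<in> U")
    case False
    then have "t \<notin> closure (U - {t})" using U(2) by simp
    then have "at t within U = bot" by (simp add: at_within_eq_bot_iff)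
    then show ?thesis by simp
  qed (rule path_continuous_onD(2)[OF U(1)])
  from Lim_Un[OF this[OF S] this[OF T]]
  show "((\<lambda>s. W12_0_norm \<Omega> (\<lambda>x. \<gamma> s x - \<gamma> t x)) \<longlongrightarrow> 0) (at t within S \<union> T)" .
qed

lemma path_continuous_on_segment:
  assumes f: "\<phi> \<in> W12_0 \<Omega>" and g: "\<eta> \<in> W12_0 \<Omega>"
  shows "path_continuous_on S (\<lambda>t x. (1 - t) * \<phi> x + t * \<eta> x)"
  unfolding path_continuous_on_def
proof (intro conjI ballI)
  show "(\<lambda>x. (1 - t) * \<phi> x + t * \<eta> x) \<in> W12_0 \<Omega>" for t using f g by (rule W12_0_lincomb)
  fix t :: real
  have "(\<lambda>x. ((1 - s) * \<phi> x + s * \<eta> x) - ((1 - t) * \<phi> x + t * \<eta> x)) = (\<lambda>x. (s - t) * (\<eta> x - \<phi> x))" for s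
    by (auto simp: algebra_simps)
  then have eq: "W12_0_norm \<Omega> (\<lambda>x. ((1 - s) * \<phi> x + s * \<eta> x) - ((1 - t) * \<phi> x + t * \<eta> x))
      = \<bar>s - t\<bar> * W12_0_norm \<Omega> (\<lambda>x. \<eta> x - \<phi> x)" for s
    using W12_0_norm_scale[OF W12_0_diff[OF g f]] by simp
  have "((\<lambda>s. \<bar>s - t\<bar> * W12_0_norm \<Omega> (\<lambda>x. \<eta> x - \<phi> x)) \<longlongrightarrow> \<bar>t - t\<bar> * W12_0_norm \<Omega> (\<lambda>x. \<eta> x - \<phi> x)) (at t within S)"
    by (intro tendsto_intros)
  then show "((\<lambda>s. W12_0_norm \<Omega> (\<lambda>x. ((1 - s) * \<phi> x + s * \<eta> x) - ((1 - t) * \<phi> x + t * \<eta> x))) \<longlongrightarrow> 0) (at t within S)"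
    unfolding eq by simp
qed

lemma path_continuous_on_L1:
  assumes \<gamma>: "path_continuous_on S \<gamma>" and t: "t \<in> S"
  shows "((\<lambda>s. L1_norm \<Omega> (\<lambda>x. \<gamma> s x - \<gamma> t x)) \<longlongrightarrow> 0) (at t within S)"
proof -
  obtain K where K: "\<And>\<phi>. \<phi> \<in> W12_0 \<Omega> \<Longrightarrow> L1_norm \<Omega> \<phi> \<le> K * W12_0_norm \<Omega> \<phi>"
    using L1_norm_le_W12_0_norm by blast
  let ?N = "\<lambda>s. W12_0_norm \<Omega> (\<lambda>x. \<gamma> s x - \<gamma> t x)"
  have "((\<lambda>s. K * ?N s) \<longlongrightarrow> K * 0) (at t within S)"
    by (intro tendsto_intros path_continuous_onD(2)[OF \<gamma> t])
  then have lim: "((\<lambda>s. K * ?N s) \<longlongrightarrow> 0) (at t within S)" by simp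
  have ev: "\<forall>\<^sub>F s in at t within S. L1_norm \<Omega> (\<lambda>x. \<gamma> s x - \<gamma> t x) \<le> K * ?N s"
    unfolding eventually_at_filter
    by (intro always_eventually allI impI K W12_0_diff path_continuous_onD(1)[OF \<gamma>] t)
  show ?thesis
    by (rule tendsto_sandwich[OF _ ev tendsto_const lim]) simp
qed

lemma path_continuous_on_dirichlet:
  assumes \<gamma>: "path_continuous_on S \<gamma>"
  shows "continuous_on S (\<lambda>t. dirichlet (\<gamma> t))"
  unfolding continuous_on_def
proof
  fix t assume t: "t \<in> S"
  let ?N = "\<lambda>s. W12_0_norm \<Omega> (\<lambda>x. \<gamma> s x - \<gamma> t x)"
  have "((\<lambda>s. (?N s)\<^sup>2 + ?N s + ?N s * dirichlet (\<gamma> t)) \<longlongrightarrow> 0\<^sup>2 + 0 + 0 * dirichlet (\<gamma> t)) (at t within S)"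
    by (intro tendsto_intros path_continuous_onD(2)[OF \<gamma> t])
  then have lim: "((\<lambda>s. (?N s)\<^sup>2 + ?N s + ?N s * dirichlet (\<gamma> t)) \<longlongrightarrow> 0) (at t within S)" by simp
  have ev: "\<forall>\<^sub>F s in at t within S. norm (dirichlet (\<gamma> s) - dirichlet (\<gamma> t)) \<le> (?N s)\<^sup>2 + ?N s + ?N s * dirichlet (\<gamma> t)"
    unfolding eventually_at_filter real_norm_def
    by (intro always_eventually allI impI dirichlet_diff_le_norm path_continuous_onD(1)[OF \<gamma>] t)
  have "((\<lambda>s. dirichlet (\<gamma> s) - dirichlet (\<gamma> t)) \<longlongrightarrow> 0) (at t within S)"
    by (rule Lim_null_comparison[OF ev lim])
  then show "((\<lambda>s. dirichlet (\<gamma> s)) \<longlongrightarrow> dirichlet (\<gamma> t)) (at t within S)"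
    by (subst LIM_zero_iff[symmetric])
qed

end

context sublinear_energy
begin

text \<open>Near t the Dirichlet integral, hence the L2 norm, is bounded and the L1 distance is
  small, so \<open>qint_diff_le\<close> applies.\<close>

lemma path_continuous_on_qint:
  assumes \<gamma>: "path_continuous_on S \<gamma>"
  shows "continuous_on S (\<lambda>t. qint (\<gamma> t))"
  unfolding continuous_on_def
proof
  fix t assume t: "t \<in> S"
  obtain C where C: "C > 0" "\<And>\<phi>. \<phi> \<in> W12_0 \<Omega> \<Longrightarrow> sqint \<phi> \<le> C * dirichlet \<phi>"
    using Poincare by blast
  have W: "\<gamma> s \<in> W12_0 \<Omega>" if "s \<in> S" for s using \<gamma> that by (rule path_continuous_onD)
  show "((\<lambda>s. qint (\<gamma> s)) \<longlongrightarrow> qint (\<gamma> t)) (at t within S)"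
  proof (rule tendstoI)
    fix \<epsilon> :: real assume \<epsilon>: "\<epsilon> > 0"
    \<comment> \<open>Bounds \<open>sqint\<close> on a neighbourhood of t; it must be fixed before
      \<delta> and K.\<close>
    define D where "D = C * (dirichlet (\<gamma> t) + 1)"
    have D: "D > 0" using C by (simp add: D_def add_nonneg_pos)
    define \<delta> where "\<delta> = \<epsilon> / (4 * D)"
    have \<delta>: "\<delta> > 0" "\<delta> * (D + D) = \<epsilon> / 2" using \<epsilon> D by (simp_all add: \<delta>_def)
    obtain K where K: "K > 0" "\<And>\<phi> \<eta>. \<phi> \<in> W12 \<Omega> \<Longrightarrow> \<eta> \<in> W12 \<Omega> \<Longrightarrow>
      \<bar>qint \<phi> - qint \<eta>\<bar> \<le> \<delta> * (sqint \<phi> + sqint \<eta>) + K * L1_norm \<Omega> (\<lambda>x. \<phi> x - \<eta> x)"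
      using qint_diff_le[OF \<delta>(1)] by blast
    have "((\<lambda>s. dirichlet (\<gamma> s)) \<longlongrightarrow> dirichlet (\<gamma> t)) (at t within S)"
      using path_continuous_on_dirichlet[OF \<gamma>] t by (simp add: continuous_on_def)
    then have "\<forall>\<^sub>F s in at t within S. dirichlet (\<gamma> s) < dirichlet (\<gamma> t) + 1"
      by (rule order_tendstoD) simp
    moreover have "\<forall>\<^sub>F s in at t within S. L1_norm \<Omega> (\<lambda>x. \<gamma> s x - \<gamma> t x) < \<epsilon> / (2 * K)"
      by (rule order_tendstoD(2)[OF path_continuous_on_L1[OF \<gamma> t]]) (use \<epsilon> K in simp)
    moreover have "\<forall>\<^sub>F s in at t within S. s \<in> S" by (simp add: eventually_at_filter)
    ultimately show "\<forall>\<^sub>F s in at t within S. dist (qint (\<gamma> s)) (qint (\<gamma> t)) < \<epsilon>"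
    proof eventually_elim
      case (elim s)
      have "C * dirichlet (\<gamma> s) \<le> D" "C * dirichlet (\<gamma> t) \<le> D"
        unfolding D_def using C elim by (intro mult_left_mono; simp)+
      then have "sqint (\<gamma> s) \<le> D" "sqint (\<gamma> t) \<le> D"
        using C(2)[OF W[OF elim(3)]] C(2)[OF W[OF t]] by linarith+
      then have "\<delta> * (sqint (\<gamma> s) + sqint (\<gamma> t)) \<le> \<delta> * (D + D)"
        using \<delta>(1) by (intro mult_left_mono) auto
      moreover have "K * L1_norm \<Omega> (\<lambda>x. \<gamma> s x - \<gamma> t x) < \<epsilon> / 2"
        using elim(2) K(1) by (simp add: field_simps)
      ultimately show ?case
        using K(2)[OF W[OF elim(3), THEN W12_0_W12] W[OF t, THEN W12_0_W12]] \<delta>(2)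
        unfolding dist_real_def by linarith
    qed
  qed
qed

lemma path_continuous_on_energy:
  "path_continuous_on S \<gamma> \<Longrightarrow> continuous_on S (\<lambda>t. F (\<gamma> t))"
  unfolding energy_eq by (intro continuous_intros path_continuous_on_dirichlet path_continuous_on_qint)

section \<open>Joining functions below an energy level\<close>

text \<open>The ends are prescribed as functions and not merely almost everywhere, so that
  concatenation needs no change of representative. Replacing \<gamma> 0 by w is left to
  \<open>Gamma\<close>, whose end conditions hold almost everywhere.\<close>

definition connectable :: "real \<Rightarrow> ('a \<Rightarrow> real) \<Rightarrow> ('a \<Rightarrow> real) \<Rightarrow> bool" where
  "connectable m \<phi> \<eta> \<longleftrightarrow> (\<exists>\<gamma>. path_continuous_on {0..1} \<gamma> \<and> (\<forall>t\<in>{0..1}. F (\<gamma> t) \<le> m) \<and>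
      \<gamma> 0 = \<phi> \<and> \<gamma> 1 = \<eta>)"

lemma connectable_sym:
  assumes "connectable m \<phi> \<eta>" shows "connectable m \<eta> \<phi>"
proof -
  obtain \<gamma> where \<gamma>: "path_continuous_on {0..1} \<gamma>" "\<forall>t\<in>{0..1}. F (\<gamma> t) \<le> m" "\<gamma> 0 = \<phi>" "\<gamma> 1 = \<eta>"
    using assms by (auto simp: connectable_def)
  have "path_continuous_on {0..1} (\<lambda>t. \<gamma> (1 - t))"
    by (rule path_continuous_on_compose[OF \<gamma>(1)]) (auto intro!: continuous_intros)
  then show ?thesis unfolding connectable_def
    using \<gamma> by (intro exI[of _ "\<lambda>t. \<gamma> (1 - t)"]) auto
qed

lemma connectable_trans:
  assumes "connectable m \<phi> \<eta>" "connectable m \<eta> \<theta>" shows "connectable m \<phi> \<theta>"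
proof -
  obtain \<gamma> where \<gamma>: "path_continuous_on {0..1} \<gamma>" "\<forall>t\<in>{0..1}. F (\<gamma> t) \<le> m" "\<gamma> 0 = \<phi>" "\<gamma> 1 = \<eta>"
    using assms(1) by (auto simp: connectable_def)
  obtain \<kappa> where \<kappa>: "path_continuous_on {0..1} \<kappa>" "\<forall>t\<in>{0..1}. F (\<kappa> t) \<le> m" "\<kappa> 0 = \<eta>" "\<kappa> 1 = \<theta>"
    using assms(2) by (auto simp: connectable_def)
  define p where "p t = (if t \<le> 1/2 then \<gamma> (2 * t) else \<kappa> (2 * t - 1))" for t :: real
  have "path_continuous_on {0..1/2} p"
    by (rule path_continuous_on_cong[OF path_continuous_on_compose[OF \<gamma>(1), of _ "\<lambda>t. 2 * t"]])
      (auto simp: p_def intro!: continuous_intros)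
  moreover have "path_continuous_on {1/2..1} p"
  proof (rule path_continuous_on_cong[OF path_continuous_on_compose[OF \<kappa>(1), of _ "\<lambda>t. 2 * t - 1"]])
    fix t :: real assume "t \<in> {1/2..1}"
    then show "\<kappa> (2 * t - 1) = p t"
    proof (cases "t = 1/2")
      case True
      show ?thesis unfolding True p_def using \<gamma>(4) \<kappa>(3) by simp
    qed (auto simp: p_def)
  qed (auto intro!: continuous_intros)
  ultimately have "path_continuous_on ({0..1/2} \<union> {1/2..1}) p"
    by (intro path_continuous_on_Un) auto
  moreover have "{0..1/2} \<union> {1/2..1} = {0..1::real}" by auto
  ultimately have "path_continuous_on {0..1} p" by simp
  then show ?thesis unfolding connectable_def
    using \<gamma> \<kappa> by (intro exI[of _ p]) (auto simp: p_def)
qed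

text \<open>Coercivity turns the common level m into one bound B, so a single \<rho> serves all
  pairs. The ends lie at level m, not m + \<epsilon>, which keeps the excess at \<epsilon> under
  concatenation.\<close>

lemma connectable_segment:
  assumes "\<epsilon> > 0"
  obtains \<rho> where "\<rho> > 0" "\<And>\<phi> \<eta>. \<phi> \<in> W12_0 \<Omega> \<Longrightarrow> \<eta> \<in> W12_0 \<Omega> \<Longrightarrow> F \<phi> \<le> m \<Longrightarrow> F \<eta> \<le> m \<Longrightarrow>
     L1_norm \<Omega> (\<lambda>x. \<phi> x - \<eta> x) < \<rho> \<Longrightarrow> connectable (m + \<epsilon>) \<phi> \<eta>"
proof -
  obtain B where B: "B \<ge> 0" "\<And>\<phi>. \<phi> \<in> W12_0 \<Omega> \<Longrightarrow> F \<phi> \<le> m \<Longrightarrow> dirichlet \<phi> \<le> B"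
    using dirichlet_bounded_of_energy_le by blast
  obtain \<rho> where \<rho>: "\<rho> > 0" "\<And>\<phi> \<eta> s. \<phi> \<in> W12_0 \<Omega> \<Longrightarrow> \<eta> \<in> W12_0 \<Omega> \<Longrightarrow> dirichlet \<phi> \<le> B \<Longrightarrow> dirichlet \<eta> \<le> B \<Longrightarrow>
     L1_norm \<Omega> (\<lambda>x. \<phi> x - \<eta> x) < \<rho> \<Longrightarrow> 0 \<le> s \<Longrightarrow> s \<le> 1 \<Longrightarrow>
     F (\<lambda>x. (1 - s) * \<phi> x + s * \<eta> x) \<le> (1 - s) * F \<phi> + s * F \<eta> + \<epsilon>"
    using energy_segment_le[OF assms B(1)] by blast
  show ?thesis
  proof (rule that[OF \<rho>(1)])
    fix \<phi> \<eta> assume f: "\<phi> \<in> W12_0 \<Omega>" "F \<phi> \<le> m" and g: "\<eta> \<in> W12_0 \<Omega>" "F \<eta> \<le> m"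
      and L: "L1_norm \<Omega> (\<lambda>x. \<phi> x - \<eta> x) < \<rho>"
    have "F (\<lambda>x. (1 - s) * \<phi> x + s * \<eta> x) \<le> m + \<epsilon>" if s: "s \<in> {0..1}" for s
    proof -
      have "F (\<lambda>x. (1 - s) * \<phi> x + s * \<eta> x) \<le> (1 - s) * F \<phi> + s * F \<eta> + \<epsilon>"
        using s by (intro \<rho>(2) f g B(2) L) auto
      also have "\<dots> \<le> (1 - s) * m + s * m + \<epsilon>"
        using s f g by (intro add_mono mult_left_mono) auto
      finally show ?thesis by (simp add: algebra_simps)
    qed
    then show "connectable (m + \<epsilon>) \<phi> \<eta>" unfolding connectable_def
      using path_continuous_on_segment[OF f(1) g(1)]
      by (intro exI[of _ "\<lambda>t x. (1 - t) * \<phi> x + t * \<eta> x"]) auto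
  qed
qed

lemma L1_norm_minus_commute: "L1_norm \<Omega> (\<lambda>x. \<phi> x - \<eta> x) = L1_norm \<Omega> (\<lambda>x. \<eta> x - \<phi> x)"
  by (simp add: L1_norm_def abs_minus_commute)

lemma connectable_of_Gamma1_infinity:
  assumes \<gamma>: "\<gamma> \<in> Gamma1_infinity \<Omega> w" and m: "\<And>t. t \<ge> 0 \<Longrightarrow> F (\<gamma> t) \<le> m"
    and w: "w \<in> W12_0 \<Omega>" "F w \<le> m" and \<epsilon>: "\<epsilon> > 0"
  shows "connectable (m + \<epsilon>) (\<gamma> 0) (\<lambda>x. - w x)"
proof -
  obtain \<rho> where \<rho>: "\<rho> > 0" "\<And>\<phi> \<eta>. \<phi> \<in> W12_0 \<Omega> \<Longrightarrow> \<eta> \<in> W12_0 \<Omega> \<Longrightarrow> F \<phi> \<le> m \<Longrightarrow> F \<eta> \<le> m \<Longrightarrow>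
     L1_norm \<Omega> (\<lambda>x. \<phi> x - \<eta> x) < \<rho> \<Longrightarrow> connectable (m + \<epsilon>) \<phi> \<eta>"
    using connectable_segment[OF \<epsilon>] by blast
  have W: "\<gamma> t \<in> W12_0 \<Omega>" if "t \<ge> 0" for t using \<gamma> that by (auto simp: Gamma1_infinity_def)
  have "((\<lambda>t. L1_norm \<Omega> (\<lambda>x. \<gamma> t x - (- w x))) \<longlongrightarrow> 0) at_top"
    using \<gamma> by (simp add: Gamma1_infinity_def)
  then have "\<forall>\<^sub>F t in at_top. L1_norm \<Omega> (\<lambda>x. \<gamma> t x - (- w x)) < \<rho>"
    using \<rho>(1) by (rule order_tendstoD)
  then have "\<forall>\<^sub>F t in at_top. L1_norm \<Omega> (\<lambda>x. \<gamma> t x - (- w x)) < \<rho> \<and> t \<ge> 0"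
    using eventually_ge_at_top by (rule eventually_conj)
  then obtain T where T: "L1_norm \<Omega> (\<lambda>x. \<gamma> T x - (- w x)) < \<rho>" "T \<ge> 0"
    by (auto dest: eventually_happens)
  \<comment> \<open>The path only tends to -w, so the bound m on its points says nothing about -w
    itself; evenness of the energy and F w \<le> m provide it.\<close>
  have "(\<lambda>x. - w x) \<in> W12_0 \<Omega>" using W12_0_scale[OF w(1), of "-1"] by simp
  then have last: "connectable (m + \<epsilon>) (\<gamma> T) (\<lambda>x. - w x)"
    using T w by (intro \<rho>(2) W m) (simp_all add: energy_neg)
  have "connectable (m + \<epsilon>) (\<gamma> 0) (\<gamma> T)"
  proof (rule connected_equivalence_relation[where S = "{0..}" and R = "\<lambda>s t. connectable (m + \<epsilon>) (\<gamma> s) (\<gamma> t)"])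
    show "connectable (m + \<epsilon>) (\<gamma> t) (\<gamma> s)" if "connectable (m + \<epsilon>) (\<gamma> s) (\<gamma> t)" for s t
      using that by (rule connectable_sym)
    show "connectable (m + \<epsilon>) (\<gamma> r) (\<gamma> t)"
      if "connectable (m + \<epsilon>) (\<gamma> r) (\<gamma> s)" "connectable (m + \<epsilon>) (\<gamma> s) (\<gamma> t)" for r s t
      using that by (rule connectable_trans)
    fix t :: real assume t: "t \<in> {0..}"
    have "((\<lambda>s. L1_norm \<Omega> (\<lambda>x. \<gamma> s x - \<gamma> t x)) \<longlongrightarrow> 0) (at t within {0..})"
      using \<gamma> t by (simp add: Gamma1_infinity_def)
    then have "\<forall>\<^sub>F s in at t within {0..}. L1_norm \<Omega> (\<lambda>x. \<gamma> s x - \<gamma> t x) < \<rho>"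
      using \<rho>(1) by (rule order_tendstoD)
    then obtain d where d: "d > 0" "\<And>s. s \<ge> 0 \<Longrightarrow> s \<noteq> t \<Longrightarrow> dist s t < d \<Longrightarrow> L1_norm \<Omega> (\<lambda>x. \<gamma> s x - \<gamma> t x) < \<rho>"
      by (auto simp: eventually_at)
    have "connectable (m + \<epsilon>) (\<gamma> t) (\<gamma> s)" if s: "s \<in> {0..} \<inter> ball t d" for s
    proof (rule \<rho>(2))
      have "L1_norm \<Omega> (\<lambda>x. \<gamma> s x - \<gamma> t x) < \<rho>"
        \<comment> \<open>The limit disregards s = t, where the distance is 0.\<close>
        using d(2)[of s] s \<rho>(1) by (cases "s = t") (auto simp: L1_norm_def dist_commute)
      then show "L1_norm \<Omega> (\<lambda>x. \<gamma> t x - \<gamma> s x) < \<rho>" by (subst L1_norm_minus_commute)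
    qed (use t s in \<open>auto intro: W m\<close>)
    then show "\<exists>U. openin (top_of_set {0..}) U \<and> t \<in> U \<and> (\<forall>s\<in>U. connectable (m + \<epsilon>) (\<gamma> t) (\<gamma> s))"
      using t d(1) by (intro exI[of _ "{0..} \<inter> ball t d"]) (auto intro: openin_open_Int)
  qed (use T in \<open>auto intro: connected_Ici\<close>)
  then show ?thesis using last by (rule connectable_trans)
qed

section \<open>Comparison of the two levels\<close>

lemma Gamma_path_continuous: "\<gamma> \<in> Gamma \<Omega> w \<Longrightarrow> path_continuous_on {0..1} \<gamma>"
  by (simp add: Gamma_def path_continuous_on_def)

text \<open>\<open>GREATEST\<close> is meaningful only when a maximum exists; continuity of the
  energy on a compact interval guarantees one.\<close>

lemma Greatest_energy_attained:
  assumes "path_continuous_on {0..1} \<gamma>"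
  obtains t where "t \<in> {0..1}" "(GREATEST e. e \<in> F ` \<gamma> ` {0..1}) = F (\<gamma> t)"
    "\<And>s. s \<in> {0..1} \<Longrightarrow> F (\<gamma> s) \<le> F (\<gamma> t)"
proof -
  have "\<exists>t\<in>{0..1}. \<forall>s\<in>{0..1}. F (\<gamma> s) \<le> F (\<gamma> t)"
    using path_continuous_on_energy[OF assms] by (intro continuous_attains_sup) auto
  then obtain t where t: "t \<in> {0..1}" "\<And>s. s \<in> {0..1} \<Longrightarrow> F (\<gamma> s) \<le> F (\<gamma> t)" by blast
  moreover have "(GREATEST e. e \<in> F ` \<gamma> ` {0..1}) = F (\<gamma> t)"
    using t by (intro Greatest_equality) auto
  ultimately show ?thesis using that by blast
qed

lemma Lambda_star_le_of_connectable:
  assumes "connectable m \<phi> (\<lambda>x. - w x)" "AE x in M. \<phi> x = w x"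
  shows "Lambda_star q \<alpha> \<Omega> w \<le> ereal m"
proof -
  obtain p where p: "path_continuous_on {0..1} p" "\<And>t. t \<in> {0..1} \<Longrightarrow> F (p t) \<le> m"
    "p 0 = \<phi>" "p 1 = (\<lambda>x. - w x)"
    using assms(1) by (auto simp: connectable_def)
  have "p \<in> Gamma \<Omega> w"
    using p assms(2) by (auto simp: Gamma_def path_continuous_on_def)
  then have "Lambda_star q \<alpha> \<Omega> w \<le> ereal (GREATEST e. e \<in> F ` p ` {0..1})"
    unfolding Lambda_star_def by (rule INF_lower)
  also have "\<dots> \<le> ereal m"
    using Greatest_energy_attained[OF p(1)] p(2) by (metis ereal_less_eq(3))
  finally show ?thesis .
qed

lemma Lambda_star_le_nu_star:
  assumes "positive_minimizer q \<alpha> \<Omega> w"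
  shows "Lambda_star q \<alpha> \<Omega> w \<le> nu_star q \<alpha> \<Omega> w"
  unfolding nu_star_def
proof (rule INF_greatest)
  fix \<gamma> assume \<gamma>: "\<gamma> \<in> Gamma1_infinity \<Omega> w"
  let ?S = "SUP \<phi>\<in>\<gamma> ` {0..}. ereal (F \<phi>)"
  have le: "ereal (F (\<gamma> t)) \<le> ?S" if "t \<ge> 0" for t
    by (rule SUP_upper) (use that in auto)
  show "Lambda_star q \<alpha> \<Omega> w \<le> ?S"
  \<comment> \<open>An infinite supremum leaves nothing to prove, and the real energy at time 0
    excludes -\<infinity>.\<close>
  proof (cases ?S)
    case (real m)
    then have m: "F (\<gamma> t) \<le> m" if "t \<ge> 0" for t using le[OF that] by simp
    have w: "w \<in> W12_0 \<Omega>" "\<And>\<phi>. \<phi> \<in> W12_0 \<Omega> \<Longrightarrow> F w \<le> F \<phi>"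
      using assms by (auto simp: positive_minimizer_def)
    have "\<gamma> 0 \<in> W12_0 \<Omega>" and AE: "AE x in M. \<gamma> 0 x = w x" using \<gamma> by (auto simp: Gamma1_infinity_def)
    \<comment> \<open>As \<gamma> 0 equals w only almost everywhere, the bound is drawn from the
      minimality of w instead of from equality of energies.\<close>
    then have "F w \<le> m" using w(2)[of "\<gamma> 0"] m[of 0] by simp
    have "Lambda_star q \<alpha> \<Omega> w \<le> ereal m"
    proof (rule ereal_le_epsilon2)
      fix \<epsilon> :: real assume "\<epsilon> > 0"
      from connectable_of_Gamma1_infinity[OF \<gamma> m w(1) \<open>F w \<le> m\<close> this]
      show "Lambda_star q \<alpha> \<Omega> w \<le> ereal m + ereal \<epsilon>"
        using Lambda_star_le_of_connectable AE by simp
    qed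
    then show ?thesis using real by simp
  next
    case MInf
    then show ?thesis using le[of 0] by simp
  qed simp
qed

lemma nu_star_le_Lambda_star:
  "nu_star q \<alpha> \<Omega> w \<le> Lambda_star q \<alpha> \<Omega> w"
  unfolding Lambda_star_def
proof (rule INF_greatest)
  fix p assume p: "p \<in> Gamma \<Omega> w"
  note pc = Gamma_path_continuous[OF p]
  define \<gamma> where "\<gamma> t = p (min t 1)" for t :: real
  have \<gamma>: "path_continuous_on {0..} \<gamma>"
    unfolding \<gamma>_def by (rule path_continuous_on_compose[OF pc]) (auto intro!: continuous_intros)
  have "\<gamma> \<in> Gamma1_infinity \<Omega> w"
    unfolding Gamma1_infinity_def
  proof (intro CollectI conjI allI impI)
    fix t :: real assume t: "0 \<le> t"
    then show "\<gamma> t \<in> L1 \<Omega>"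
      using W12_integrable(3)[OF W12_0_W12[OF path_continuous_onD(1)[OF \<gamma>, of t]]] by (simp add: L1_def)
    show "((\<lambda>s. L1_norm \<Omega> (\<lambda>x. \<gamma> s x - \<gamma> t x)) \<longlongrightarrow> 0) (at t within {0..})"
      using t by (intro path_continuous_on_L1[OF \<gamma>]) simp
  next
    show "\<gamma> ` {0..} \<subseteq> W12_0 \<Omega>" using path_continuous_onD(1)[OF \<gamma>] by auto
    show "AE x in M. \<gamma> 0 x = w x" using p by (simp add: Gamma_def \<gamma>_def)
    have "AE x in M. p 1 x = - w x" using p by (simp add: Gamma_def)
    then have "AE x in M. \<bar>p 1 x - (- w x)\<bar> = 0" by eventually_elim simp
    then have "L1_norm \<Omega> (\<lambda>x. p 1 x - (- w x)) = 0"
      unfolding L1_norm_def by (rule integral_eq_zero_AE)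
    moreover have "\<forall>\<^sub>F t in at_top. p 1 = \<gamma> t"
      using eventually_ge_at_top[of 1] by eventually_elim (simp add: \<gamma>_def min_absorb2)
    ultimately have "\<forall>\<^sub>F t in at_top. 0 = L1_norm \<Omega> (\<lambda>x. \<gamma> t x - (- w x))"
      by (auto elim: eventually_mono)
    then show "((\<lambda>t. L1_norm \<Omega> (\<lambda>x. \<gamma> t x - (- w x))) \<longlongrightarrow> 0) at_top"
      by (rule Lim_transform_eventually[OF tendsto_const])
  qed
  then have "nu_star q \<alpha> \<Omega> w \<le> (SUP \<phi>\<in>\<gamma> ` {0..}. ereal (F \<phi>))"
    unfolding nu_star_def by (rule INF_lower)
  also have "\<dots> \<le> ereal (GREATEST e. e \<in> F ` p ` {0..1})"
  proof (rule SUP_least)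
    obtain t where t: "(GREATEST e. e \<in> F ` p ` {0..1}) = F (p t)" "\<And>s. s \<in> {0..1} \<Longrightarrow> F (p s) \<le> F (p t)"
      using Greatest_energy_attained[OF pc] by metis
    show "ereal (F \<phi>) \<le> ereal (GREATEST e. e \<in> F ` p ` {0..1})" if "\<phi> \<in> \<gamma> ` {0..}" for \<phi>
      unfolding t(1) using that t(2) by (auto simp: \<gamma>_def)
  qed
  finally show "nu_star q \<alpha> \<Omega> w \<le> ereal (GREATEST e. e \<in> F ` p ` {0..1})" .
qed

end

theorem corollary4p3:
  fixes q \<alpha> :: real
    and \<Omega> :: "'a::euclidean_space set"
    and w :: "'a \<Rightarrow> real"
  assumes "1 < q" and "q < 2" and "\<alpha> > 0"
    and "open \<Omega>" and "bounded \<Omega>" and "connected \<Omega>"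
    and "positive_minimizer q \<alpha> \<Omega> w"
  shows "nu_star q \<alpha> \<Omega> w = Lambda_star q \<alpha> \<Omega> w"
proof -
  interpret sublinear_energy \<Omega> q \<alpha>
    using assms by unfold_locales
  show ?thesis
    using nu_star_le_Lambda_star Lambda_star_le_nu_star[OF assms(7)] by (rule antisym)
qed

end
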